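(* Let $k$ be an infinite field, let $\mathbf{R}=k[x,y,z]$, and let $n\ge 3$. Then the Rees algebra $\mathbf{R}[It]$ of the ideal $I=I(n,n,n,1,1,1)=(x^n,y^n,z^n,xyz)$ of $\mathbf{R}$ is almost Cohen--Macaulay.
   Context: Here $I(a,b,c,\alpha,\beta,\gamma)$ denotes the monomial ideal $(x^a,y^b,z^c,x^\alpha y^\beta z^\gamma)$ of the polynomial ring $k[x,y,z]$. For an ideal $I$ of a polynomial ring $\mathbf{R}$ in $d$ variables over a field, the Rees algebra is $\mathbf{R}[It]=\bigoplus_{j\ge 0}I^jt^j$. It is called almost Cohen--Macaulay if $\operatorname{depth}\mathbf{R}[It]\ge d$ (here $d=3$), with depth taken with respect to the maximal homogeneous ideal generated by the variables and $It$. *)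

theory Defs
  imports
    "HOL-Algebra.Algebraic_Closure_Type"
    "HOL-Algebra.Ideal_Product"
    "HOL-Library.Poly_Mapping"
    "HOL-Library.Numeral_Type"
    "HOL-Library.Extended_Nat"
begin

section \<open>Regular sequences and depth\<close>

text \<open>
  The regularity condition says that \<open>xs ! i\<close> is a nonzerodivisor on the quotient of \<open>R\<close> by the
  ideal generated by the preceding elements; the last condition says that the quotient by
  the whole sequence is nonzero.
\<close>

definition regular_sequence :: "('a, 'm) ring_scheme \<Rightarrow> 'a list \<Rightarrow> bool" where
  "regular_sequence R xs \<longleftrightarrow>
     set xs \<subseteq> carrier R \<and>
     (\<forall>i < length xs. \<forall>b \<in> carrier R.
        xs ! i \<otimes>\<^bsub>R\<^esub> b \<in> Idl\<^bsub>R\<^esub> (set (take i xs)) \<longrightarrow> b \<in> Idl\<^bsub>R\<^esub> (set (take i xs))) \<and>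
     Idl\<^bsub>R\<^esub> (set xs) \<noteq> carrier R"

text \<open>
  The depth of \<open>R\<close> with respect to an ideal \<open>M\<close>. For \<open>R\<close> Noetherian and \<open>M\<close> proper the supremum is
  the common length of all maximal \<open>R\<close>-regular sequences in \<open>M\<close>.
\<close>

definition depth :: "('a, 'm) ring_scheme \<Rightarrow> 'a set \<Rightarrow> enat" where
  "depth R M = (SUP xs \<in> {xs. regular_sequence R xs \<and> set xs \<subseteq> M}. enat (length xs))"


section \<open>Polynomial rings and Rees algebras\<close>

text \<open>
  The polynomial ring over \<open>'k\<close> in the variables indexed by \<open>'v\<close>: an element maps exponent
  vectors in \<open>'v \<Rightarrow>\<^sub>0 nat\<close> to coefficients, and multiplication is convolution.
\<close>

type_synonym ('v, 'k) mpoly = "('v \<Rightarrow>\<^sub>0 nat) \<Rightarrow>\<^sub>0 'k"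

definition var :: "'v \<Rightarrow> ('v, 'k::comm_ring_1) mpoly" where
  "var i = Poly_Mapping.single (Poly_Mapping.single i 1) 1"

text \<open>
  The Rees algebra is realised as a subring of the univariate polynomial ring over the base ring,
  whose variable plays the role of \<open>t\<close>. The power of \<open>I\<close> is taken in the monoid of ideals, so
  its zeroth power is the whole base ring.
\<close>

definition rees_algebra :: "'a::comm_ring_1 set \<Rightarrow> 'a poly ring" where
  "rees_algebra I = ring_of_type_algebra
     \<lparr>carrier := {p. \<forall>j. Polynomial.coeff p j \<in> I [^]\<^bsub>ideals_set ring_of_type_algebra\<^esub> j}\<rparr>"

definition rees_max_ideal :: "('v, 'k::field) mpoly set \<Rightarrow> ('v, 'k) mpoly poly set" where
  "rees_max_ideal I = Idl\<^bsub>rees_algebra I\<^esub>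
     ((\<lambda>i. [:var i:]) ` UNIV \<union> (\<lambda>a. Polynomial.monom a 1) ` I)"

definition almost_Cohen_Macaulay_rees :: "('v::finite, 'k::field) mpoly set \<Rightarrow> bool" where
  "almost_Cohen_Macaulay_rees I \<longleftrightarrow>
     enat CARD('v) \<le> depth (rees_algebra I) (rees_max_ideal I)"


section \<open>The monomial ideals in three variables\<close>

text \<open>The variables \<open>x\<close>, \<open>y\<close>, \<open>z\<close> are indexed by the elements \<open>0\<close>, \<open>1\<close>, \<open>2\<close> of the type \<open>3\<close>.\<close>

definition mon_ideal ::
    "nat \<Rightarrow> nat \<Rightarrow> nat \<Rightarrow> nat \<Rightarrow> nat \<Rightarrow> nat \<Rightarrow> (3, 'k::field) mpoly set" where
  "mon_ideal a b c \<alpha> \<beta> \<gamma> = Idl\<^bsub>ring_of_type_algebra\<^esub>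
     {var 0 ^ a, var 1 ^ b, var 2 ^ c, var 0 ^ \<alpha> * var 1 ^ \<beta> * var 2 ^ \<gamma>}"

end

theory Submission
  imports Defs "HOL-Library.Product_Plus"
begin

text \<open>
  The Rees algebra \<open>A\<close> is spanned by the monomials \<open>x^a y^b z^c t^j\<close> with exponents in a semigroup \<open>S\<close>,
  and \<open>w = xyzt\<close>, \<open>g1 = x^n + y^n t + z^n t\<close>, \<open>g2 = y^n + x^n t + z^n t\<close> is a regular sequence in \<open>A\<close>.
  To see that \<open>g1, g2\<close> is regular on \<open>A / w A\<close>, filter this quotient by submodules spanned by
  monomials; regularity on the successive layers is enough. The layers are spanned by the
  monomials of \<open>A\<close> with \<open>c = 0\<close>; with \<open>b = 0 < c\<close>; with \<open>a = 0 < b, c\<close>; with \<open>j = 0 < a, b, c\<close>; and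
  by \<open>z (x^n t)^p (y^n t)^q\<close>, \<open>p, q > 0\<close>, and the two families obtained from these by permuting the
  variables. On each layer \<open>g1\<close> and \<open>g2\<close> act as sums of at most two of their terms. On the last four
  layers the claim is about monomials. On the first three it holds in the full polynomial ring,
  because a combination of \<open>g1\<close> and \<open>g2\<close> with coefficients in \<open>k[t]\<close> is free of a variable in which one
  of them is monic; and the quotient by a binomial \<open>u^n + v^n t\<close> stays in the layer.
\<close>

section \<open>Coefficients and supports\<close>

text \<open>A tuple \<open>(a, b, c, j)\<close> stands for the monomial
  \<open>x^a y^b z^c t^j\<close>. Tuples are added componentwise, so their sum corresponds to the
  product of monomials.\<close>

type_synonym expo = "nat \<times> nat \<times> nat \<times> nat"

type_synonym 'k bpoly = "(3, 'k) mpoly poly"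

definition expv :: "nat \<Rightarrow> nat \<Rightarrow> nat \<Rightarrow> 3 \<Rightarrow>\<^sub>0 nat" where
  "expv a b c = Poly_Mapping.single 0 a + Poly_Mapping.single 1 b + Poly_Mapping.single 2 c"

fun cf :: "'k::field bpoly \<Rightarrow> expo \<Rightarrow> 'k" where
  "cf p (a, b, c, j) = Poly_Mapping.lookup (Polynomial.coeff p j) (expv a b c)"

fun mon :: "expo \<Rightarrow> 'k::field bpoly" where
  "mon (a, b, c, j) = Polynomial.monom (Poly_Mapping.single (expv a b c) 1) j"

definition const :: "'k::field \<Rightarrow> 'k bpoly" where
  "const k = [:Poly_Mapping.single 0 k:]"

text \<open>The \<open>k\<close>-span of the monomials with exponents in \<open>U\<close>. The Rees
  algebra and all submodules of the filtration have this form, so inclusions and disjointness are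
  checked on exponents.\<close>

definition supported :: "expo set \<Rightarrow> 'k::field bpoly set" where
  "supported U = {p. \<forall>w. cf p w \<noteq> 0 \<longrightarrow> w \<in> U}"

lemma exhaust_three: "(i::3) = 0 \<or> i = 1 \<or> i = 2"
proof (cases i)
  case (of_int z)
  then have "z = 0 \<or> z = 1 \<or> z = 2" by auto
  then show ?thesis using of_int by auto
qed

lemma lookup_expv:
  "Poly_Mapping.lookup (expv a b c) 0 = a" "Poly_Mapping.lookup (expv a b c) 1 = b"
  "Poly_Mapping.lookup (expv a b c) 2 = c"
  by (simp_all add: expv_def lookup_add lookup_single)

lemma expv_eta:
  "expv (Poly_Mapping.lookup u 0) (Poly_Mapping.lookup u 1) (Poly_Mapping.lookup u 2) = u"
  (is "?v = u")
proof (rule poly_mapping_eqI)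
  fix i :: 3
  show "Poly_Mapping.lookup ?v i = Poly_Mapping.lookup u i"
    using exhaust_three[of i] by (auto simp: lookup_expv)
qed

lemma expv_cases: obtains a b c where "u = expv a b c"
  by (metis expv_eta)

lemma expv_add: "expv a b c + expv a' b' c' = expv (a + a') (b + b') (c + c')"
  by (simp add: expv_def single_add algebra_simps)

lemma expv_inject [simp]: "expv a b c = expv a' b' c' \<longleftrightarrow> a = a' \<and> b = b' \<and> c = c'"
  by (metis lookup_expv)

lemma expv_0 [simp]: "expv 0 0 0 = 0"
  by (simp add: expv_def)

lemma cf_eqI: assumes "\<And>w. cf p w = cf q w" shows "p = q"
proof (rule poly_eqI, rule poly_mapping_eqI)
  fix j u
  obtain a b c where "u = expv a b c" by (rule expv_cases)
  then show "Poly_Mapping.lookup (Polynomial.coeff p j) u = Poly_Mapping.lookup (Polynomial.coeff q j) u"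
    using assms[of "(a, b, c, j)"] by simp
qed

lemma cf_0 [simp]: "cf 0 w = 0"
  and cf_add [simp]: "cf (p + q) w = cf p w + cf q w"
  and cf_uminus [simp]: "cf (- p) w = - cf p w"
  and cf_diff [simp]: "cf (p - q) w = cf p w - cf q w"
  by (cases w; simp add: lookup_add lookup_minus)+

lemma cf_sum: "cf (\<Sum>i\<in>A. f i) w = (\<Sum>i\<in>A. cf (f i) w)"
  by (induction A rule: infinite_finite_induct) auto

declare cf.simps [simp del] mon.simps [simp del]

lemma mon_add: "mon (v + w) = mon v * mon w"
  by (cases v; cases w) (simp add: mon.simps mult_monom mult_single expv_add)

lemma mon_zero [simp]: "mon 0 = 1"
  by (simp add: zero_prod_def mon.simps monom_0 flip: one_pCons)

lemma const_mult: "const (k * l) = const k * const l"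
  by (simp add: const_def mult_single mult.commute)

lemma cf_const_mon: "cf (const k * mon w) v = (if v = w then k else 0)"
  by (cases v; cases w)
    (auto simp: cf.simps mon.simps const_def smult_monom mult_single lookup_single when_def)

lemma cf_mon: "cf (mon w) v = (if v = w then 1 else 0)"
  by (cases v; cases w) (auto simp: cf.simps mon.simps lookup_single when_def)

lemma finite_cf: "finite {w. cf p w \<noteq> 0}"
proof (rule finite_subset)
  show "{w. cf p w \<noteq> 0} \<subseteq> (\<lambda>(j, u).
      (Poly_Mapping.lookup u 0, Poly_Mapping.lookup u 1, Poly_Mapping.lookup u 2, j)) `
      (SIGMA j:{..degree p}. Poly_Mapping.keys (Polynomial.coeff p j))" (is "_ \<subseteq> ?f ` ?S")
  proof
    fix w assume w: "w \<in> {w. cf p w \<noteq> 0}"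
    obtain a b c j where [simp]: "w = (a, b, c, j)" by (cases w)
    have "expv a b c \<in> Poly_Mapping.keys (Polynomial.coeff p j)"
      using w by (simp add: cf.simps in_keys_iff)
    moreover from this have "j \<le> degree p"
      by (metis coeff_eq_0 keys_zero empty_iff not_le)
    ultimately have "(j, expv a b c) \<in> ?S" by simp
    then show "w \<in> ?f ` ?S" by (force simp: lookup_expv)
  qed
qed auto

lemma mon_expansion: "p = (\<Sum>w | cf p w \<noteq> 0. const (cf p w) * mon w)"
proof (rule cf_eqI)
  fix v
  have "(\<Sum>w | cf p w \<noteq> 0. if v = w then cf p w else 0) = cf p v"
    by (subst sum.delta') (use finite_cf in auto)
  then show "cf p v = cf (\<Sum>w | cf p w \<noteq> 0. const (cf p w) * mon w) v"
    by (simp add: cf_sum cf_const_mon)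
qed

section \<open>Spans of sets of monomials\<close>

lemma supportedD: "p \<in> supported U \<Longrightarrow> w \<notin> U \<Longrightarrow> cf p w = 0"
  unfolding supported_def by blast

lemma supportedI: "(\<And>w. w \<notin> U \<Longrightarrow> cf p w = 0) \<Longrightarrow> p \<in> supported U"
  unfolding supported_def by blast

lemma supported_induct [consumes 1, case_names zero add mon]:
  assumes p: "p \<in> supported U"
    and "P 0" "\<And>p q. P p \<Longrightarrow> P q \<Longrightarrow> P (p + q)" "\<And>k w. w \<in> U \<Longrightarrow> P (const k * mon w)"
  shows "P p"
proof -
  have "P (\<Sum>w\<in>A. const (cf p w) * mon w)" if "finite A" "A \<subseteq> U" for A
    using that by (induction A) (auto intro: assms)
  moreover have "{w. cf p w \<noteq> 0} \<subseteq> U" using p unfolding supported_def by blast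
  ultimately have "P (\<Sum>w | cf p w \<noteq> 0. const (cf p w) * mon w)"
    using finite_cf by blast
  then show ?thesis using mon_expansion[of p] by simp
qed

lemma supported_UNIV [simp]: "p \<in> supported UNIV"
  by (simp add: supported_def)

lemma supported_0 [simp]: "0 \<in> supported U"
  by (simp add: supported_def)

lemma supported_add: "p \<in> supported U \<Longrightarrow> q \<in> supported U \<Longrightarrow> p + q \<in> supported U"
  by (intro supportedI) (simp add: supportedD)

lemma supported_uminus: "p \<in> supported U \<Longrightarrow> - p \<in> supported U"
  by (intro supportedI) (simp add: supportedD)

lemma supported_diff: "p \<in> supported U \<Longrightarrow> q \<in> supported U \<Longrightarrow> p - q \<in> supported U"
  by (intro supportedI) (simp add: supportedD)

lemma supported_mono: "p \<in> supported U \<Longrightarrow> U \<subseteq> U' \<Longrightarrow> p \<in> supported U'"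
  unfolding supported_def by blast

lemma supported_Int: "p \<in> supported U \<Longrightarrow> p \<in> supported U' \<Longrightarrow> p \<in> supported (U \<inter> U')"
  unfolding supported_def by blast

lemma supported_disjoint:
  assumes "p \<in> supported U" "p \<in> supported U'" "U \<inter> U' = {}"
  shows "p = 0"
proof (rule cf_eqI)
  fix w
  have "w \<notin> U \<or> w \<notin> U'" using assms(3) by blast
  then show "cf p w = cf 0 w" using assms(1,2) by (auto dest: supportedD)
qed

lemma supported_const_mon: "w \<in> U \<Longrightarrow> const k * mon w \<in> supported U"
  by (auto simp: supported_def cf_const_mon split: if_splits)

lemma supported_mon: "w \<in> U \<Longrightarrow> mon w \<in> supported U"
  by (auto simp: supported_def cf_mon split: if_splits)

lemma supported_mult:
  assumes p: "p \<in> supported U" and q: "q \<in> supported V"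
    and UV: "\<And>u v. u \<in> U \<Longrightarrow> v \<in> V \<Longrightarrow> u + v \<in> W"
  shows "p * q \<in> supported W"
  using p
proof (induction rule: supported_induct)
  case (mon k w)
  show ?case using q
  proof (induction rule: supported_induct)
    case (mon l v)
    have "const k * mon w * (const l * mon v) = const (k * l) * mon (w + v)"
      by (simp add: mon_add const_mult mult_ac)
    then show ?case using UV[OF \<open>w \<in> U\<close> \<open>v \<in> V\<close>] by (simp add: supported_const_mon)
  qed (auto simp: distrib_left intro: supported_add)
qed (auto simp: distrib_right intro: supported_add)

lemma supported_mon_mult:
  assumes "p \<in> supported U" "\<And>u. u \<in> U \<Longrightarrow> u + m \<in> W"
  shows "mon m * p \<in> supported W"
  using assms by (intro supported_mult[of _ "{m}" _ U]) (auto simp: supported_mon add.commute)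

lemma cf_mon_mult_0:
  assumes "\<And>v. w \<noteq> v + m" shows "cf (mon m * p) w = 0"
proof -
  have "mon m * p \<in> supported {v + m | v. True}"
    by (rule supported_mon_mult[of _ UNIV]) auto
  then show ?thesis by (rule supportedD) (use assms in blast)
qed

lemma cf_mon_mult [simp]: "cf (mon m * p) (w + m) = cf p w"
proof (rule supported_induct[OF supported_UNIV[of p]])
  fix k v
  have "mon m * (const k * mon v) = const k * mon (v + m)"
    by (simp only: mon_add mult_ac)
  then show "cf (mon m * (const k * mon v)) (w + m) = cf (const k * mon v) w"
    by (simp only: cf_const_mon add_right_cancel)
qed (auto simp: distrib_left)

lemma supported_split:
  assumes "p \<in> supported A"
  obtains p1 p2 where "p = p1 + p2" "p1 \<in> supported (A \<inter> U)" "p2 \<in> supported (A - U)"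
proof -
  from assms have "\<exists>p1 p2. p = p1 + p2 \<and> p1 \<in> supported (A \<inter> U) \<and> p2 \<in> supported (A - U)"
  proof (induction rule: supported_induct)
    case zero
    show ?case by (intro exI[of _ 0]) simp
  next
    case (add p q)
    then obtain p1 p2 q1 q2 where "p = p1 + p2" "q = q1 + q2"
      "p1 \<in> supported (A \<inter> U)" "p2 \<in> supported (A - U)"
      "q1 \<in> supported (A \<inter> U)" "q2 \<in> supported (A - U)" by blast
    then show ?case
      by (intro exI[of _ "p1 + q1"] exI[of _ "p2 + q2"]) (auto intro: supported_add)
  next
    case (mon k w)
    show ?case
    proof (cases "w \<in> U")
      case True
      then show ?thesis using mon
        by (intro exI[of _ "const k * mon w"] exI[of _ 0]) (auto intro: supported_const_mon)
    next
      case False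
      then show ?thesis using mon
        by (intro exI[of _ 0] exI[of _ "const k * mon w"]) (auto intro: supported_const_mon)
    qed
  qed
  then show ?thesis using that by blast
qed

text \<open>The quotient is built term by term. Since addition of exponents is cancellative, its
  coefficient at \<open>w\<close> is that of \<open>p\<close> at \<open>w + m\<close>, which bounds
  its support.\<close>

lemma mon_dvd:
  assumes "p \<in> supported {v + m | v. v \<in> U}"
  obtains c where "c \<in> supported U" "p = mon m * c"
proof -
  have "\<exists>c. p = mon m * c" using assms
  proof (induction rule: supported_induct)
    case (mon k w)
    then obtain v where "w = v + m" by blast
    then have "const k * mon w = mon m * (const k * mon v)" by (simp add: mon_add mult_ac)
    then show ?case ..
  qed (metis mult_zero_right, metis distrib_left)
  then obtain c where c: "p = mon m * c" ..
  have "c \<in> supported U"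
  proof (rule supportedI)
    fix w assume "w \<notin> U"
    then have "w + m \<notin> {v + m | v. v \<in> U}" by auto
    then have "cf p (w + m) = 0" using assms supportedD by blast
    then show "cf c w = 0" by (simp add: c)
  qed
  then show ?thesis using c that by blast
qed

text \<open>Descent on \<open>f\<close>. The coefficient of the product at \<open>w + m\<close> is
  zero by \<open>out\<close>, and it is \<open>cf p w\<close> plus the coefficient of
  \<open>p\<close> at the exponent \<open>w'\<close> with \<open>w + m = w' + m'\<close>, if there
  is one. That \<open>w'\<close> is again in \<open>B\<close> and has smaller \<open>f\<close>, so
  \<open>cf p w'\<close> vanishes already.\<close>

lemma supported_binomial_quotient:
  fixes f :: "expo \<Rightarrow> nat"
  assumes prod: "(mon m + mon m') * p \<in> supported U"
    and out: "\<And>w. w \<in> B \<Longrightarrow> w + m \<notin> U"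
    and descend: "\<And>w w'. w \<in> B \<Longrightarrow> w + m = w' + m' \<Longrightarrow> w' \<in> B \<and> f w' < f w"
  shows "p \<in> supported (- B)"
proof -
  have "cf p w = 0" if "w \<in> B" for w
    using that
  proof (induction "f w" arbitrary: w rule: less_induct)
    case less
    have "cf (mon m' * p) (w + m) = 0"
    proof (cases "\<exists>w'. w + m = w' + m'")
      case True
      then show ?thesis using less descend by (metis cf_mon_mult)
    qed (auto intro: cf_mon_mult_0)
    moreover have "cf ((mon m + mon m') * p) (w + m) = 0"
      using prod out[OF \<open>w \<in> B\<close>] by (rule supportedD)
    ultimately show ?case by (simp add: distrib_right)
  qed
  then show ?thesis by (intro supportedI) simp
qed

section \<open>Division by an element that is monic in one variable\<close>

lemma supported_bounded:
  fixes h :: "expo \<Rightarrow> nat"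
  obtains N where "p \<in> supported {w. h w < N}"
proof -
  have "finite (h ` {w. cf p w \<noteq> 0})" using finite_cf by blast
  then obtain N where "\<forall>i \<in> h ` {w. cf p w \<noteq> 0}. i < N"
    using finite_nat_set_iff_bounded by blast
  then have "p \<in> supported {w. h w < N}" unfolding supported_def by blast
  then show ?thesis by (rule that)
qed

text \<open>Models \<open>h\<close> as the degree in one variable and \<open>mon m\<close> as a
  power of that variable: by \<open>h_ge\<close> this power divides every monomial of at least its
  degree. If \<open>\<rho>\<close> has degree 0, then \<open>mon m + \<rho>\<close> is monic in the
  variable.\<close>

locale exponent_degree =
  fixes h :: "expo \<Rightarrow> nat" and m :: expo
  assumes h_add: "h (v + w) = h v + h w"
    and h_pos: "0 < h m"
    and h_ge: "h m \<le> h w \<Longrightarrow> \<exists>v. w = v + m"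
begin

text \<open>Long division, by induction on a degree bound \<open>N\<close>.\<close>

lemma monic_division:
  assumes \<rho>: "\<rho> \<in> supported {w. h w = 0}"
  shows "\<exists>q r. p = (mon m + \<rho>) * q + r \<and> r \<in> supported {w. h w < h m}"
proof -
  have "\<exists>q r. p = (mon m + \<rho>) * q + r \<and> r \<in> supported {w. h w < h m}"
    if "p \<in> supported {w. h w < N}" for p N
    using that
  proof (induction N arbitrary: p rule: less_induct)
    case (less N)
    show ?case
    proof (cases "N \<le> h m")
      case True
      then have "p \<in> supported {w. h w < h m}"
        by (intro supported_mono[OF less.prems]) auto
      then show ?thesis by (intro exI[of _ 0] exI[of _ p]) simp
    next
      case False
      obtain p1 p2 where p: "p = p1 + p2"
        and p1: "p1 \<in> supported ({w. h w < N} \<inter> {w. h w < h m})"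
        and p2: "p2 \<in> supported ({w. h w < N} - {w. h w < h m})"
        using supported_split[OF less.prems] by metis
      have p2': "p2 \<in> supported {v + m | v. v \<in> {v. h v + h m < N}}"
      proof (rule supported_mono[OF p2], rule subsetI)
        fix w assume "w \<in> {w. h w < N} - {w. h w < h m}"
        then have "h w < N" "h m \<le> h w" by auto
        then obtain v where "w = v + m" using h_ge by blast
        moreover from this have "h v + h m < N" using \<open>h w < N\<close> h_add[of v m] by metis
        ultimately show "w \<in> {v + m | v. v \<in> {v. h v + h m < N}}" by blast
      qed
      obtain c where c: "c \<in> supported {v. h v + h m < N}" "p2 = mon m * c"
        by (rule mon_dvd[OF p2'])
      \<comment> \<open>Modulo the divisor, \<open>mon m * c\<close> may be replaced by
        \<open>- \<rho> * c\<close>, which lowers the degree bound by \<open>h m\<close>; the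
        maximum in the new bound accounts for \<open>p1\<close>.\<close>
      have "\<rho> * c \<in> supported {w. h w < N - h m}"
        by (rule supported_mult[OF \<rho> c(1)]) (simp add: h_add less_diff_conv)
      moreover have "{w. h w < N} \<inter> {w. h w < h m} \<subseteq> {w. h w < max (h m) (N - h m)}"
        by auto
      then have "p1 \<in> supported {w. h w < max (h m) (N - h m)}"
        by (rule supported_mono[OF p1])
      moreover have "{w. h w < N - h m} \<subseteq> {w. h w < max (h m) (N - h m)}" by auto
      ultimately have "p1 - \<rho> * c \<in> supported {w. h w < max (h m) (N - h m)}"
        by (meson supported_diff supported_mono)
      moreover have "max (h m) (N - h m) < N" using False h_pos by auto
      ultimately obtain q r where qr: "p1 - \<rho> * c = (mon m + \<rho>) * q + r"
        "r \<in> supported {w. h w < h m}" using less.IH by blast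
      have "p = (mon m + \<rho>) * (q + c) + r"
        using qr(1) by (simp add: p c(2) algebra_simps)
      then show ?thesis using qr(2) by blast
    qed
  qed
  moreover obtain N where "p \<in> supported {w. h w < N}" by (rule supported_bounded)
  ultimately show ?thesis by blast
qed

text \<open>The terms of top degree in \<open>q\<close>, multiplied by \<open>mon m\<close>, land at
  exponents that \<open>\<rho> * q\<close> does not reach, so they cannot cancel. Hence any bound on
  the degree of \<open>q\<close> can be lowered, down to 0.\<close>

lemma monic_quotient_degree:
  assumes \<rho>: "\<rho> \<in> supported {w. h w = 0}"
    and r: "(mon m + \<rho>) * q \<in> supported {w. h w < h m}"
  shows "q = 0"
proof -
  have "q \<in> supported {w. h w < N}" if "q \<in> supported {w. h w < Suc N}" for N
  proof -
    have "cf q w = 0" if "h w = N" for w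
    proof -
      have "\<rho> * q \<in> supported {w. h w < Suc N}"
        by (rule supported_mult[OF \<rho> \<open>q \<in> supported {w. h w < Suc N}\<close>]) (simp add: h_add)
      then have "cf (\<rho> * q) (w + m) = 0"
        by (rule supportedD) (use that h_pos in \<open>simp add: h_add\<close>)
      moreover have "cf ((mon m + \<rho>) * q) (w + m) = 0"
        using r by (rule supportedD) (simp add: h_add)
      ultimately show ?thesis by (simp add: distrib_right)
    qed
    then show ?thesis
      using that by (intro supportedI) (auto dest: supportedD simp: less_Suc_eq)
  qed
  then have "q \<in> supported {w. h w < N} \<Longrightarrow> q \<in> supported {w. h w < 0}" for N
    by (induction N) auto
  moreover obtain N where "q \<in> supported {w. h w < N}" by (rule supported_bounded)
  ultimately have "q \<in> supported {}" by auto
  then show ?thesis by (intro supported_disjoint[of q "{}" "{}"]) auto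
qed

text \<open>\<open>\<delta>\<close> is a nonzerodivisor modulo the monic element: for the remainder
  \<open>r\<close> of \<open>b\<close>, the product \<open>\<delta> * r\<close> is a multiple of the
  monic element of too small a degree, hence zero, and the ring is a domain.\<close>

lemma monic_dvd_cancel:
  assumes \<rho>: "\<rho> \<in> supported {w. h w = 0}"
    and \<delta>: "\<delta> \<in> supported {w. h w = 0}" "\<delta> \<noteq> 0"
    and eq: "\<delta> * b = (mon m + \<rho>) * a"
  obtains c where "b = (mon m + \<rho>) * c"
proof -
  obtain c r where b: "b = (mon m + \<rho>) * c + r" and r: "r \<in> supported {w. h w < h m}"
    using monic_division[OF \<rho>] by blast
  have "\<delta> * r = (mon m + \<rho>) * (a - \<delta> * c)"
    using eq by (simp add: b algebra_simps)
  moreover have "\<delta> * r \<in> supported {w. h w < h m}"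
    by (rule supported_mult[OF \<delta>(1) r]) (simp add: h_add)
  ultimately have "a - \<delta> * c = 0"
    using monic_quotient_degree[OF \<rho>] by metis
  with \<open>\<delta> * r = _\<close> \<delta>(2) have "r = 0" by simp
  then show ?thesis using b that by (metis add_0_right)
qed

end

section \<open>Regular pairs on quotients\<close>

text \<open>For a submodule \<open>B\<close> of \<open>A\<close>, the two clauses say that
  \<open>g1\<close> is a nonzerodivisor on \<open>A / B\<close> and \<open>g2\<close> is one on
  \<open>A / (B + g1 A)\<close>. That the last quotient is nonzero is a separate matter, settled in
  \<open>regular_sequence_rees\<close>.\<close>

definition reg_pair :: "'a::comm_ring_1 \<Rightarrow> 'a \<Rightarrow> 'a set \<Rightarrow> 'a set \<Rightarrow> bool" where
  "reg_pair g1 g2 A B \<longleftrightarrow>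
     (\<forall>b\<in>A. g1 * b \<in> B \<longrightarrow> b \<in> B) \<and>
     (\<forall>a\<in>A. \<forall>b\<in>A. g2 * b - g1 * a \<in> B \<longrightarrow> (\<exists>c\<in>A. b - g1 * c \<in> B))"

definition stable :: "'k::field bpoly \<Rightarrow> expo set \<Rightarrow> bool" where
  "stable g U \<longleftrightarrow> (\<forall>p \<in> supported U. g * p \<in> supported U)"

text \<open>Regularity passes from the outer terms of \<open>0 -> B/C -> A/C -> A/B -> 0\<close> to
  the middle one. A relation on \<open>A / C\<close> is corrected by a trivial relation so that it
  lives in \<open>B\<close>.\<close>

lemma reg_pair_trans:
  assumes AB: "reg_pair g1 g2 (supported A) (supported B)"
    and BC: "reg_pair g1 g2 (supported B) (supported C)"
    and sub: "C \<subseteq> B" "B \<subseteq> A" and stab: "stable g2 A" "stable g2 B"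
  shows "reg_pair g1 g2 (supported A) (supported C)"
  unfolding reg_pair_def
proof (intro conjI ballI impI)
  fix b assume "b \<in> supported A" "g1 * b \<in> supported C"
  then show "b \<in> supported C"
    using AB BC sub(1) unfolding reg_pair_def by (meson supported_mono)
next
  fix a b assume a: "a \<in> supported A" and b: "b \<in> supported A"
    and C: "g2 * b - g1 * a \<in> supported C"
  then have "g2 * b - g1 * a \<in> supported B" using sub(1) supported_mono by blast
  then obtain c where c: "c \<in> supported A" "b - g1 * c \<in> supported B"
    using AB a b unfolding reg_pair_def by blast
  \<comment> \<open>Subtracting \<open>g2 * (g1 * c) = g1 * (g2 * c)\<close> replaces
    \<open>b\<close> by \<open>b - g1 * c\<close> and \<open>a\<close> by \<open>a - g2 * c\<close>.
    Regularity of \<open>g1\<close> on \<open>A / B\<close> then brings the latter into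
    \<open>B\<close>.\<close>
  have "g2 * (b - g1 * c) \<in> supported B" using stab(2) c(2) by (simp add: stable_def)
  then have "g1 * (a - g2 * c) \<in> supported B"
    using supported_diff[OF _ \<open>g2 * b - g1 * a \<in> supported B\<close>] by (force simp: algebra_simps)
  moreover have "a - g2 * c \<in> supported A"
    using stab(1) a c(1) by (simp add: stable_def supported_diff)
  ultimately have "a - g2 * c \<in> supported B"
    using AB unfolding reg_pair_def by blast
  moreover have "g2 * (b - g1 * c) - g1 * (a - g2 * c) = g2 * b - g1 * a"
    by (simp add: algebra_simps)
  ultimately obtain d where d: "d \<in> supported B" "b - g1 * c - g1 * d \<in> supported C"
    using BC C c(2) unfolding reg_pair_def by metis
  have "c + d \<in> supported A" using c(1) d(1) sub(2) by (meson supported_add supported_mono)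
  moreover have "b - g1 * (c + d) \<in> supported C" using d(2) by (simp add: algebra_simps)
  ultimately show "\<exists>c\<in>supported A. b - g1 * c \<in> supported C" by blast
qed

text \<open>The elements \<open>\<gamma>1\<close> and \<open>\<gamma>2\<close> are the parts of \<open>g1\<close> and \<open>g2\<close> that do not annihilate the layer.\<close>

lemma reg_pair_layer:
  assumes disj: "L \<inter> V = {}" and stab: "stable g1 V" "stable g2 V"
    and act1: "\<And>p. p \<in> supported L \<Longrightarrow> \<gamma>1 * p \<in> supported L \<and> (g1 - \<gamma>1) * p \<in> supported V"
    and act2: "\<And>p. p \<in> supported L \<Longrightarrow> \<gamma>2 * p \<in> supported L \<and> (g2 - \<gamma>2) * p \<in> supported V"
    and nz: "\<gamma>1 \<noteq> 0"
    and coprime: "\<And>a b. a \<in> supported L \<Longrightarrow> b \<in> supported L \<Longrightarrow> \<gamma>2 * b = \<gamma>1 * a \<Longrightarrow>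
      \<exists>c\<in>supported L. b = \<gamma>1 * c"
  shows "reg_pair g1 g2 (supported (L \<union> V)) (supported V)"
  unfolding reg_pair_def
proof (intro conjI ballI impI)
  have split: "\<exists>p1 p2. p = p1 + p2 \<and> p1 \<in> supported L \<and> p2 \<in> supported V"
    if "p \<in> supported (L \<union> V)" for p
  proof -
    obtain p1 p2 where "p = p1 + p2" "p1 \<in> supported ((L \<union> V) \<inter> L)" "p2 \<in> supported (L \<union> V - L)"
      using supported_split[OF \<open>p \<in> supported (L \<union> V)\<close>, of L] .
    moreover have "(L \<union> V) \<inter> L = L" "L \<union> V - L = V" using disj by auto
    ultimately show ?thesis by metis
  qed
  {
    fix b assume "b \<in> supported (L \<union> V)" and g: "g1 * b \<in> supported V"
    then obtain b1 b2 where b: "b = b1 + b2" "b1 \<in> supported L" "b2 \<in> supported V"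
      using split by metis
    have "\<gamma>1 * b1 = g1 * b - g1 * b2 - (g1 - \<gamma>1) * b1" by (simp add: b algebra_simps)
    also have "\<dots> \<in> supported V"
      using g b act1 stab by (intro supported_diff) (auto simp: stable_def)
    finally have "\<gamma>1 * b1 = 0"
      using act1[OF b(2)] disj supported_disjoint by blast
    then show "b \<in> supported V" using nz b by simp
  next
    fix a b assume "a \<in> supported (L \<union> V)" "b \<in> supported (L \<union> V)"
      and g: "g2 * b - g1 * a \<in> supported V"
    then obtain a1 a2 b1 b2 where a: "a = a1 + a2" "a1 \<in> supported L" "a2 \<in> supported V"
      and b: "b = b1 + b2" "b1 \<in> supported L" "b2 \<in> supported V"
      using split by metis
    \<comment> \<open>Only the components in \<open>L\<close> survive modulo \<open>V\<close>. Two
      summands carry a double minus sign so that closure under differences covers all terms.\<close>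
    have "\<gamma>2 * b1 - \<gamma>1 * a1 = (g2 * b - g1 * a) - g2 * b2 - (g2 - \<gamma>2) * b1 - (- (g1 * a2))
        - (- ((g1 - \<gamma>1) * a1))"
      by (simp add: a b algebra_simps)
    also have "\<dots> \<in> supported V"
      using g a(2,3) b(2,3) act1 act2 stab unfolding stable_def
      by (intro supported_diff[OF supported_diff[OF supported_diff[OF supported_diff]]]
          supported_uminus) blast+
    finally have "\<gamma>2 * b1 - \<gamma>1 * a1 = 0"
      using act1[OF a(2)] act2[OF b(2)] disj supported_disjoint supported_diff by blast
    then obtain c where c: "c \<in> supported L" "b1 = \<gamma>1 * c"
      using coprime[OF a(2) b(2)] by auto
    have "b - g1 * c = b2 - (g1 - \<gamma>1) * c" by (simp add: b c algebra_simps)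
    also have "\<dots> \<in> supported V" using b act1[OF c(1)] by (simp add: supported_diff)
    finally show "\<exists>c\<in>supported (L \<union> V). b - g1 * c \<in> supported V"
      using c(1) supported_mono by blast
  }
qed

text \<open>Supplies the last hypothesis of \<open>reg_pair_layer\<close> when both elements act as
  single monomials. Every exponent \<open>w\<close> of \<open>b\<close> satisfies
  \<open>w + m2 = w' + m1\<close> for an exponent \<open>w'\<close> of \<open>a\<close>, so
  divisibility of \<open>b\<close> becomes a question about exponents in \<open>L\<close>.\<close>

lemma mon_coprime:
  assumes a: "a \<in> supported L" and b: "b \<in> supported L" and eq: "mon m2 * b = mon m1 * a"
    and L: "\<And>w w'. w \<in> L \<Longrightarrow> w' \<in> L \<Longrightarrow> w + m2 = w' + m1 \<Longrightarrow> \<exists>v\<in>L. w = v + m1"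
  shows "\<exists>c\<in>supported L. b = mon m1 * c"
proof -
  have "b \<in> supported {v + m1 | v. v \<in> L}"
  proof (rule supportedI)
    fix w assume w: "w \<notin> {v + m1 | v. v \<in> L}"
    show "cf b w = 0"
    proof (rule ccontr)
      assume nz: "cf b w \<noteq> 0"
      then have "cf (mon m1 * a) (w + m2) \<noteq> 0" by (simp flip: eq)
      then obtain w' where w': "w + m2 = w' + m1" using cf_mon_mult_0 by metis
      with \<open>cf (mon m1 * a) (w + m2) \<noteq> 0\<close> have "cf a w' \<noteq> 0" by simp
      then show False using L[OF _ _ w'] w nz a b supportedD by blast
    qed
  qed
  then show ?thesis by (rule mon_dvd) blast
qed

section \<open>The exponents of the Rees algebra\<close>

text \<open>The monomials \<open>x^a y^b z^c t^j\<close> with \<open>x^a y^b z^c\<close> in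
  \<open>I^j\<close>: some product of \<open>j\<close> generators divides it, with \<open>m\<close>
  factors \<open>xyz\<close> and \<open>p\<close>, \<open>q\<close>, \<open>r\<close> factors
  \<open>x^n\<close>, \<open>y^n\<close>, \<open>z^n\<close>.\<close>

definition rees_expo :: "nat \<Rightarrow> expo set" where
  "rees_expo n = {(a, b, c, j). \<exists>m p q r. j = m + p + q + r \<and>
     m + n * p \<le> a \<and> m + n * q \<le> b \<and> m + n * r \<le> c}"

definition rees_expo_xyzt :: "nat \<Rightarrow> expo set" where
  "rees_expo_xyzt n = {w + (1, 1, 1, 1) | w. w \<in> rees_expo n}"

lemma rees_expo_xyzt_iff:
  "(a, b, c, j) \<in> rees_expo_xyzt n \<longleftrightarrow>
     a > 0 \<and> b > 0 \<and> c > 0 \<and> j > 0 \<and> (a - 1, b - 1, c - 1, j - 1) \<in> rees_expo n"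
proof
  assume "(a, b, c, j) \<in> rees_expo_xyzt n"
  then show "a > 0 \<and> b > 0 \<and> c > 0 \<and> j > 0 \<and> (a - 1, b - 1, c - 1, j - 1) \<in> rees_expo n"
    by (auto simp: rees_expo_xyzt_def)
next
  assume "a > 0 \<and> b > 0 \<and> c > 0 \<and> j > 0 \<and> (a - 1, b - 1, c - 1, j - 1) \<in> rees_expo n"
  then have "(a, b, c, j) = (a - 1, b - 1, c - 1, j - 1) + (1, 1, 1, 1)"
    "(a - 1, b - 1, c - 1, j - 1) \<in> rees_expo n" by auto
  then show "(a, b, c, j) \<in> rees_expo_xyzt n" unfolding rees_expo_xyzt_def by blast
qed

lemma rees_expo_add:
  assumes "v \<in> rees_expo n" "w \<in> rees_expo n" shows "v + w \<in> rees_expo n"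
proof -
  obtain a b c j a' b' c' j' where vw: "v = (a, b, c, j)" "w = (a', b', c', j')"
    by (metis prod_cases4)
  with assms obtain m p q r m' p' q' r' where
    "j = m + p + q + r" "m + n * p \<le> a" "m + n * q \<le> b" "m + n * r \<le> c"
    "j' = m' + p' + q' + r'" "m' + n * p' \<le> a'" "m' + n * q' \<le> b'" "m' + n * r' \<le> c'"
    unfolding rees_expo_def by auto
  then have "(a + a', b + b', c + c', j + j') \<in> rees_expo n"
    unfolding rees_expo_def mem_Collect_eq prod.case
    by (intro exI[of _ "m + m'"] exI[of _ "p + p'"] exI[of _ "q + q'"] exI[of _ "r + r'"])
      (simp add: algebra_simps)
  then show ?thesis by (simp add: vw)
qed

lemma rees_expo_intro:
  "j = m + p + q + r \<Longrightarrow> m + n * p \<le> a \<Longrightarrow> m + n * q \<le> b \<Longrightarrow> m + n * r \<le> c \<Longrightarrow>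
   (a, b, c, j) \<in> rees_expo n"
  unfolding rees_expo_def by blast

lemma rees_expo_0: "(a, b, c, 0) \<in> rees_expo n"
  by (rule rees_expo_intro[of _ 0 0 0 0]) auto

lemma rees_expo_gens:
  "(n, 0, 0, 1) \<in> rees_expo n" "(0, n, 0, 1) \<in> rees_expo n" "(0, 0, n, 1) \<in> rees_expo n"
  "(1, 1, 1, 1) \<in> rees_expo n"
  using rees_expo_intro[of 1 0 1 0 0 n n 0 0] rees_expo_intro[of 1 0 0 1 0 n 0 n 0]
    rees_expo_intro[of 1 0 0 0 1 n 0 0 n] rees_expo_intro[of 1 1 0 0 0 n 1 1 1]
  by simp_all

text \<open>A monomial free of one variable is divisible neither by \<open>xyz\<close> nor by the
  power of that variable. Only two kinds of generators can be split off, and they do not compete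
  with each other.\<close>

lemma rees_expo_zero_cases:
  assumes "n > 0"
  shows "(a, b, 0, j) \<in> rees_expo n \<longleftrightarrow> j \<le> a div n + b div n"
    and "(a, 0, c, j) \<in> rees_expo n \<longleftrightarrow> j \<le> a div n + c div n"
    and "(0, b, c, j) \<in> rees_expo n \<longleftrightarrow> j \<le> b div n + c div n"
proof -
  have *: "(\<exists>p q. j = p + q \<and> n * p \<le> u \<and> n * q \<le> v) \<longleftrightarrow> j \<le> u div n + v div n" for u v
  proof
    assume "\<exists>p q. j = p + q \<and> n * p \<le> u \<and> n * q \<le> v"
    then show "j \<le> u div n + v div n"
      using assms by (auto simp: less_eq_div_iff_mult_less_eq mult.commute intro!: add_mono)
  next
    assume j: "j \<le> u div n + v div n"
    \<comment> \<open>As many of the \<open>j\<close> factors as possible are of the first kind, the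
      rest of the second.\<close>
    have "min j (u div n) \<le> u div n" "j - min j (u div n) \<le> v div n" using j by auto
    then have "n * min j (u div n) \<le> u" "n * (j - min j (u div n)) \<le> v"
      using assms by (metis less_eq_div_iff_mult_less_eq mult.commute)+
    then show "\<exists>p q. j = p + q \<and> n * p \<le> u \<and> n * q \<le> v"
      by (intro exI[of _ "min j (u div n)"] exI[of _ "j - min j (u div n)"]) auto
  qed
  show "(a, b, 0, j) \<in> rees_expo n \<longleftrightarrow> j \<le> a div n + b div n"
    using assms *[of a b] by (auto simp: rees_expo_def)
  show "(a, 0, c, j) \<in> rees_expo n \<longleftrightarrow> j \<le> a div n + c div n"
    using assms *[of a c] by (auto simp: rees_expo_def)
  show "(0, b, c, j) \<in> rees_expo n \<longleftrightarrow> j \<le> b div n + c div n"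
    using assms *[of b c] by (auto simp: rees_expo_def)
qed

section \<open>Monomials with positive exponents that \<open>xyzt\<close> does not divide in
  \<open>A\<close>\<close>

definition corner_xy :: "nat \<Rightarrow> expo set" where
  "corner_xy n = {(n * p, n * q, 1, p + q) | p q. p > 0 \<and> q > 0}"

definition corner_xz :: "nat \<Rightarrow> expo set" where
  "corner_xz n = {(n * p, 1, n * q, p + q) | p q. p > 0 \<and> q > 0}"

definition corner_yz :: "nat \<Rightarrow> expo set" where
  "corner_yz n = {(1, n * p, n * q, p + q) | p q. p > 0 \<and> q > 0}"

lemma corner_subset: "corner_xy n \<subseteq> rees_expo n" "corner_xz n \<subseteq> rees_expo n" "corner_yz n \<subseteq> rees_expo n"
proof -
  show "corner_xy n \<subseteq> rees_expo n"
    unfolding corner_xy_def by clarify (rule rees_expo_intro[of _ 0 _ _ 0], auto)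
  show "corner_xz n \<subseteq> rees_expo n"
    unfolding corner_xz_def by clarify (rule rees_expo_intro[of _ 0 _ 0 _], auto)
  show "corner_yz n \<subseteq> rees_expo n"
    unfolding corner_yz_def by clarify (rule rees_expo_intro[of _ 0 0 _ _], auto)
qed

text \<open>Dividing \<open>z (x^n t)^p (y^n t)^q\<close> by \<open>xyzt\<close> leaves no
  \<open>z\<close>, and the exponents \<open>n p - 1\<close> and \<open>n q - 1\<close> have room
  for at most \<open>(p - 1) + (q - 1)\<close> generators, one less than the power
  \<open>p + q - 1\<close> of \<open>t\<close> requires. The families differ because 1 is not a
  multiple of \<open>n\<close>.\<close>

lemma corner_disjoint:
  assumes "n \<ge> 3"
  shows "corner_xy n \<inter> rees_expo_xyzt n = {}" "corner_xz n \<inter> rees_expo_xyzt n = {}"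
    "corner_yz n \<inter> rees_expo_xyzt n = {}"
    "corner_xy n \<inter> corner_xz n = {}" "corner_xy n \<inter> corner_yz n = {}" "corner_xz n \<inter> corner_yz n = {}"
proof -
  have div: "(n * p - 1) div n + (n * q - 1) div n < p + q - Suc 0" if "p > 0" "q > 0" for p q
  proof -
    have "(n * p - 1) div n < p" "(n * q - 1) div n < q"
      using that assms by (auto simp: div_less_iff_less_mult mult.commute)
    then show ?thesis by linarith
  qed
  have n: "n > 0" using assms by simp
  show "corner_xy n \<inter> rees_expo_xyzt n = {}"
    unfolding corner_xy_def using div
    by (auto simp: rees_expo_xyzt_iff rees_expo_zero_cases[OF n] simp flip: not_less)
  show "corner_xz n \<inter> rees_expo_xyzt n = {}"
    unfolding corner_xz_def using div
    by (auto simp: rees_expo_xyzt_iff rees_expo_zero_cases[OF n] simp flip: not_less)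
  show "corner_yz n \<inter> rees_expo_xyzt n = {}"
    unfolding corner_yz_def using div
    by (auto simp: rees_expo_xyzt_iff rees_expo_zero_cases[OF n] simp flip: not_less)
  show "corner_xy n \<inter> corner_xz n = {}" "corner_xy n \<inter> corner_yz n = {}" "corner_xz n \<inter> corner_yz n = {}"
    using assms by (auto simp: corner_xy_def corner_xz_def corner_yz_def)
qed

text \<open>
  The identities \<open>x^n y^n z^2 t^2 = (xyzt)^2 (xy)^(n-2)\<close> and \<open>x^n y^n z^n t^3 = (xyzt)^3 (xyz)^(n-3)\<close>
  leave no other monomials outside the ideal generated by \<open>xyzt\<close>.
\<close>

lemma corner_cases:
  assumes "n \<ge> 3" "(a, b, c, j) \<in> rees_expo n" "a > 0" "b > 0" "c > 0" "j > 0"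
  shows "(a, b, c, j) \<in> corner_xy n \<union> corner_xz n \<union> corner_yz n \<union> rees_expo_xyzt n"
proof -
  let ?C = "corner_xy n \<union> corner_xz n \<union> corner_yz n \<union> rees_expo_xyzt n"
  obtain m p q r where j: "j = m + p + q + r"
    and le: "m + n * p \<le> a" "m + n * q \<le> b" "m + n * r \<le> c"
    using assms(2) unfolding rees_expo_def by auto
  \<comment> \<open>For divisibility by \<open>xyzt\<close> in \<open>A\<close>, some
    \<open>j - 1\<close> generators must still fit after each exponent has dropped by one. All cases
    except the corners supply them.\<close>
  have *: "(a, b, c, j) \<in> ?C"
    if "j - 1 = m' + p' + q' + r'" "m' + n * p' \<le> a - 1" "m' + n * q' \<le> b - 1" "m' + n * r' \<le> c - 1"
    for m' p' q' r'
    using rees_expo_intro[OF that] assms(3-) by (simp add: rees_expo_xyzt_iff)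
  show ?thesis
  proof (cases m)
    case (Suc m')
    then show ?thesis using j le by (intro *[of m' p q r]) auto
  next
    case 0
    consider p' q' r' where "p = Suc p'" "q = Suc q'" "r = Suc r'"
      | p' q' where "p = Suc p'" "q = Suc q'" "r = 0"
      | p' r' where "p = Suc p'" "q = 0" "r = Suc r'"
      | q' r' where "p = 0" "q = Suc q'" "r = Suc r'"
      | p' where "p = Suc p'" "q = 0" "r = 0"
      | q' where "p = 0" "q = Suc q'" "r = 0"
      | r' where "p = 0" "q = 0" "r = Suc r'"
      using 0 j assms(6) by (metis add_is_0 neq0_conv not0_implies_Suc)
    then show ?thesis
    proof cases
      case 1
      \<comment> \<open>One factor each of \<open>x^n\<close>, \<open>y^n\<close>,
        \<open>z^n\<close> is traded for three factors \<open>xyz\<close>, one of which is divided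
        out; hence the 2.\<close>
      then show ?thesis using 0 j le assms by (intro *[of 2 p' q' r']) auto
    next
      case 2
      show ?thesis
      proof (cases "c = 1")
        case True
        show ?thesis
        proof (cases "a = n * p \<and> b = n * q")
          case True
          then have "(a, b, c, j) \<in> corner_xy n"
            using \<open>c = 1\<close> 2 j 0 unfolding corner_xy_def
            by (intro CollectI exI[of _ p] exI[of _ q]) auto
          then show ?thesis by blast
        next
          case False
          \<comment> \<open>A surplus in one of the two exponents pays for that variable in
            \<open>xyzt\<close>, so the generator given up is a power of the other variable.\<close>
          then consider "n * p < a" | "n * q < b" using 0 le by force
          then show ?thesis
          proof cases
            case 1
            then show ?thesis using 0 j le assms 2 by (intro *[of 0 p q' 0]) auto
          next
            assume "n * q < b"
            then show ?thesis using 0 j le assms 2 by (intro *[of 0 p' q 0]) auto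
          qed
        qed
      next
        case False
        \<comment> \<open>With \<open>c\<close> at least 2, one \<open>x^n\<close> and one
          \<open>y^n\<close> are traded for two factors \<open>xyz\<close>, one of which is divided
          out.\<close>
        then show ?thesis using 0 j le assms 2 by (intro *[of 1 p' q' 0]) auto
      qed
    next
      case 3
      show ?thesis
      proof (cases "b = 1")
        case True
        show ?thesis
        proof (cases "a = n * p \<and> c = n * r")
          case True
          then have "(a, b, c, j) \<in> corner_xz n"
            using \<open>b = 1\<close> 3 j 0 unfolding corner_xz_def
            by (intro CollectI exI[of _ p] exI[of _ r]) auto
          then show ?thesis by blast
        next
          case False
          then consider "n * p < a" | "n * r < c" using 0 le by force
          then show ?thesis
          proof cases
            case 1
            then show ?thesis using 0 j le assms 3 by (intro *[of 0 p 0 r']) auto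
          next
            assume "n * r < c"
            then show ?thesis using 0 j le assms 3 by (intro *[of 0 p' 0 r]) auto
          qed
        qed
      next
        case False
        then show ?thesis using 0 j le assms 3 by (intro *[of 1 p' 0 r']) auto
      qed
    next
      case 4
      show ?thesis
      proof (cases "a = 1")
        case True
        show ?thesis
        proof (cases "b = n * q \<and> c = n * r")
          case True
          then have "(a, b, c, j) \<in> corner_yz n"
            using \<open>a = 1\<close> 4 j 0 unfolding corner_yz_def
            by (intro CollectI exI[of _ q] exI[of _ r]) auto
          then show ?thesis by blast
        next
          case False
          then consider "n * q < b" | "n * r < c" using 0 le by force
          then show ?thesis
          proof cases
            case 1
            then show ?thesis using 0 j le assms 4 by (intro *[of 0 0 q r']) auto
          next
            assume "n * r < c"
            then show ?thesis using 0 j le assms 4 by (intro *[of 0 0 q' r]) auto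
          qed
        qed
      next
        case False
        then show ?thesis using 0 j le assms 4 by (intro *[of 1 0 q' r']) auto
      qed
    next
      case 5
      then show ?thesis using 0 j le assms by (intro *[of 0 p' 0 0]) auto
    next
      case 6
      then show ?thesis using 0 j le assms by (intro *[of 0 0 q' 0]) auto
    next
      case 7
      then show ?thesis using 0 j le assms by (intro *[of 0 0 0 r']) auto
    qed
  qed
qed

section \<open>The layers modulo \<open>xyzt\<close>\<close>

lemma stable_add: "stable g U \<Longrightarrow> stable g' U \<Longrightarrow> stable (g + g') U"
  by (simp add: stable_def distrib_right supported_add)

lemma stable_mon: "(\<And>w. w \<in> U \<Longrightarrow> w + m \<in> U) \<Longrightarrow> stable (mon m) U"
  by (simp add: stable_def supported_mon_mult)

lemma mon_neq_0 [simp]: "mon m \<noteq> 0"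
  by (metis cf_mon cf_0 zero_neq_one)

lemma mon_add_neq_0: "m \<noteq> m' \<Longrightarrow> mon m + mon m' \<noteq> 0"
  by (metis cf_mon cf_0 cf_add add_0_right zero_neq_one)

lemma mon_inject [simp]: "mon v = mon w \<longleftrightarrow> v = w"
  by (metis cf_mon zero_neq_one)

text \<open>\<open>param1\<close> and \<open>param2\<close> are \<open>g1\<close> and
  \<open>g2\<close> of the overview. Each contains the power of one variable without
  \<open>t\<close> and is monic in that variable over the remaining ones.\<close>

definition param1 :: "nat \<Rightarrow> 'k::field bpoly" where
  "param1 n = mon (n, 0, 0, 0) + mon (0, n, 0, 1) + mon (0, 0, n, 1)"

definition param2 :: "nat \<Rightarrow> 'k::field bpoly" where
  "param2 n = mon (0, n, 0, 0) + mon (n, 0, 0, 1) + mon (0, 0, n, 1)"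

lemma param_stable:
  assumes "\<And>w m. w \<in> U \<Longrightarrow> m \<in> {(n, 0, 0, 0), (0, n, 0, 0), (n, 0, 0, 1), (0, n, 0, 1), (0, 0, n, 1)} \<Longrightarrow>
    w + m \<in> U"
  shows "stable (param1 n) U" "stable (param2 n) U"
  unfolding param1_def param2_def by (intro stable_add stable_mon assms; simp)+

section \<open>Divisibility and quotients by binomials\<close>

lemma monic_dvd_x:
  assumes "n > 0" "\<rho> \<in> supported {(a, b, c, j). a = 0}" "\<delta> \<in> supported {(a, b, c, j). a = 0}"
    "\<delta> \<noteq> 0" "\<delta> * b = (mon (n, 0, 0, 0) + \<rho>) * a"
  obtains c where "b = (mon (n, 0, 0, 0) + \<rho>) * c"
proof -
  interpret exponent_degree "\<lambda>(a, b, c, j). a" "(n, 0, 0, 0)"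
  proof
    fix w :: expo assume "(case (n, 0, 0, 0) of (a, b, c, j) \<Rightarrow> a) \<le> (case w of (a, b, c, j) \<Rightarrow> a)"
    then show "\<exists>v. w = v + (n, 0, 0, 0)"
      by (cases w) (auto intro!: exI[of _ "fst w - n"])
  qed (use assms in \<open>auto split: prod.splits\<close>)
  have "{w. (case w of (a, b, c, j) \<Rightarrow> a) = 0} = {(a, b, c, j). a = 0}" by auto
  then show ?thesis using monic_dvd_cancel[of \<rho> \<delta> b a] assms that by metis
qed

lemma monic_dvd_y:
  assumes "n > 0" "\<rho> \<in> supported {(a, b, c, j). b = 0}" "\<delta> \<in> supported {(a, b, c, j). b = 0}"
    "\<delta> \<noteq> 0" "\<delta> * b = (mon (0, n, 0, 0) + \<rho>) * a"
  obtains c where "b = (mon (0, n, 0, 0) + \<rho>) * c"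
proof -
  interpret exponent_degree "\<lambda>(a, b, c, j). b" "(0, n, 0, 0)"
  proof
    fix w :: expo assume "(case (0, n, 0, 0) of (a, b, c, j) \<Rightarrow> b) \<le> (case w of (a, b, c, j) \<Rightarrow> b)"
    then show "\<exists>v. w = v + (0, n, 0, 0)"
      by (cases w) (auto intro!: exI[of _ "fst (snd w) - n"])
  qed (use assms in \<open>auto split: prod.splits\<close>)
  have "{w. (case w of (a, b, c, j) \<Rightarrow> b) = 0} = {(a, b, c, j). b = 0}" by auto
  then show ?thesis using monic_dvd_cancel[of \<rho> \<delta> b a] assms that by metis
qed

text \<open>Multiplication by \<open>y^n t\<close> raises both sides of
  \<open>j \<le> a div n + b div n\<close> by one, and trading \<open>x^n\<close> for
  \<open>y^n t\<close> raises only \<open>j\<close>. So monomials outside the layer stay outside,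
  and the descent runs on the exponent of \<open>x\<close>.\<close>

lemma quotient_z0:
  assumes n: "n > 0"
    and p: "(mon (n, 0, 0, 0) + mon (0, n, 0, 1)) * p \<in>
      supported (rees_expo n \<inter> {(a, b, c, j). c = 0})"
  shows "p \<in> supported (rees_expo n \<inter> {(a, b, c, j). c = 0})"
proof -
  have L: "rees_expo n \<inter> {(a, b, c, j). c = 0} = {(a, b, c, j). c = 0 \<and> j \<le> a div n + b div n}"
    using rees_expo_zero_cases(1)[OF n] by auto
  have "p \<in> supported (- {(a, b, c, j). \<not> (c = 0 \<and> j \<le> a div n + b div n)})"
    by (rule supported_binomial_quotient[where f = fst and m = "(0, n, 0, 1)" and m' = "(n, 0, 0, 0)"
          and U = "{(a, b, c, j). c = 0 \<and> j \<le> a div n + b div n}"])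
      (use p n in \<open>auto simp: L add.commute\<close>)
  then show ?thesis unfolding L by (rule supported_mono) auto
qed

lemma quotient_y0:
  assumes n: "n > 0"
    and p: "(mon (n, 0, 0, 0) + mon (0, 0, n, 1)) * p \<in>
      supported (rees_expo n \<inter> {(a, b, c, j). b = 0 \<and> c > 0})"
  shows "p \<in> supported (rees_expo n \<inter> {(a, b, c, j). b = 0 \<and> c > 0})"
proof -
  define U :: "expo set" where "U = {(a, b, c, j). b = 0 \<and> c > 0 \<and> j \<le> a div n + c div n}"
  have L: "rees_expo n \<inter> {(a, b, c, j). b = 0 \<and> c > 0} = U"
    using rees_expo_zero_cases(2)[OF n] by (auto simp: U_def)
  have p': "(mon (n, 0, 0, 0) + mon (0, 0, n, 1)) * p \<in> supported U"
    "(mon (0, 0, n, 1) + mon (n, 0, 0, 0)) * p \<in> supported U"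
    using p by (simp_all only: L add.commute)
  \<comment> \<open>Positivity of \<open>c\<close> is left to a second descent: multiplication by
    \<open>z^n t\<close> makes \<open>c\<close> positive, so it would not keep monomials with
    \<open>c = 0\<close> outside \<open>U\<close>.\<close>
  have "p \<in> supported (- {(a, b, c, j). \<not> (b = 0 \<and> j \<le> a div n + c div n)})"
    by (rule supported_binomial_quotient[where f = fst and m = "(0, 0, n, 1)" and m' = "(n, 0, 0, 0)" and U = U,
          OF p'(2)])
      (use n in \<open>auto simp: U_def add.commute\<close>)
  \<comment> \<open>The roles of the two terms are exchanged. With \<open>c = 0\<close> there is no
    factor \<open>z^n t\<close> to trade, so the descent stops at once.\<close>
  moreover have "p \<in> supported (- {(a, b, c, j). c = 0})"
    by (rule supported_binomial_quotient[where f = fst and m = "(n, 0, 0, 0)" and m' = "(0, 0, n, 1)" and U = U,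
          OF p'(1)])
      (use n in \<open>auto simp: U_def\<close>)
  ultimately have "p \<in> supported (- {(a, b, c, j). \<not> (b = 0 \<and> j \<le> a div n + c div n)}
      \<inter> - {(a, b, c, j). c = 0})"
    by (rule supported_Int)
  then show ?thesis unfolding L by (rule supported_mono) (auto simp: U_def)
qed

text \<open>As for \<open>b = 0\<close>, with \<open>y\<close> in the role of \<open>x\<close>.
  Monomials with \<open>b = 0\<close> are excluded in the first descent, since \<open>z^n t\<close>
  does not change \<open>b\<close> and no \<open>y^n\<close> is there to be traded.\<close>

lemma quotient_x0:
  assumes n: "n > 0"
    and p: "(mon (0, n, 0, 0) + mon (0, 0, n, 1)) * p \<in>
      supported (rees_expo n \<inter> {(a, b, c, j). a = 0 \<and> b > 0 \<and> c > 0})"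
  shows "p \<in> supported (rees_expo n \<inter> {(a, b, c, j). a = 0 \<and> b > 0 \<and> c > 0})"
proof -
  define U :: "expo set" where "U = {(a, b, c, j). a = 0 \<and> b > 0 \<and> c > 0 \<and> j \<le> b div n + c div n}"
  have L: "rees_expo n \<inter> {(a, b, c, j). a = 0 \<and> b > 0 \<and> c > 0} = U"
    using rees_expo_zero_cases(3)[OF n] by (auto simp: U_def)
  have p': "(mon (0, n, 0, 0) + mon (0, 0, n, 1)) * p \<in> supported U"
    "(mon (0, 0, n, 1) + mon (0, n, 0, 0)) * p \<in> supported U"
    using p by (simp_all only: L add.commute)
  have "p \<in> supported (- {(a, b, c, j). \<not> (a = 0 \<and> b > 0 \<and> j \<le> b div n + c div n)})"
    by (rule supported_binomial_quotient[where f = "\<lambda>(a, b, c, j). b" and m = "(0, 0, n, 1)" and m' = "(0, n, 0, 0)" and U = U,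
          OF p'(2)])
      (use n in \<open>auto simp: U_def add.commute\<close>)
  moreover have "p \<in> supported (- {(a, b, c, j). c = 0})"
    by (rule supported_binomial_quotient[where f = fst and m = "(0, n, 0, 0)" and m' = "(0, 0, n, 1)" and U = U,
          OF p'(1)])
      (use n in \<open>auto simp: U_def\<close>)
  ultimately have "p \<in> supported (- {(a, b, c, j). \<not> (a = 0 \<and> b > 0 \<and> j \<le> b div n + c div n)}
      \<inter> - {(a, b, c, j). c = 0})"
    by (rule supported_Int)
  then show ?thesis unfolding L by (rule supported_mono) (auto simp: U_def)
qed


section \<open>Regularity on the layers with a vanishing exponent\<close>

lemma rees_expo_shift:
  "w \<in> rees_expo n \<Longrightarrow>
   m \<in> {(n, 0, 0, 0), (0, n, 0, 0), (n, 0, 0, 1), (0, n, 0, 1), (0, 0, n, 1)} \<Longrightarrow>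
   w + m \<in> rees_expo n"
  using rees_expo_add rees_expo_gens rees_expo_0 by blast

text \<open>The term \<open>z^n t\<close> leads out of the layer \<open>c = 0\<close>, so
  \<open>g1\<close> and \<open>g2\<close> act as \<open>x^n + y^n t\<close> and
  \<open>y^n + x^n t\<close>. Eliminating \<open>x^n\<close> gives \<open>(1 - t^2) y^n\<close>,
  which is free of \<open>x\<close>, while the first binomial is monic in \<open>x\<close>.\<close>

lemma layer_z0:
  assumes n: "n > 0"
  shows "reg_pair (param1 n) (param2 n) (supported (rees_expo n))
    (supported (rees_expo n \<inter> {(a, b, c, j). c > 0}) :: 'k::field bpoly set)"
proof -
  define L where "L = rees_expo n \<inter> {(a, b, c, j). c = 0}"
  define V where "V = rees_expo n \<inter> {(a, b, c, j). c > 0}"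
  let ?x = "mon (n, 0, 0, 0) :: 'k bpoly" and ?y = "mon (0, n, 0, 0) :: 'k bpoly"
  let ?tx = "mon (n, 0, 0, 1) :: 'k bpoly" and ?ty = "mon (0, n, 0, 1) :: 'k bpoly"
  have "reg_pair (param1 n) (param2 n) (supported (L \<union> V) :: 'k bpoly set) (supported V)"
  proof (rule reg_pair_layer)
    show "L \<inter> V = {}" by (auto simp: L_def V_def)
    show "stable (param1 n) V" "stable (param2 n) V"
      unfolding V_def by (intro param_stable; use rees_expo_shift in fastforce)+
    show "?x + ?ty \<noteq> 0" using n by (simp add: mon_add_neq_0)
    fix p :: "'k bpoly" assume p: "p \<in> supported L"
    have "mon (0, 0, n, 1) * p \<in> supported V"
      using p by (rule supported_mon_mult) (use n rees_expo_shift in \<open>fastforce simp: L_def V_def\<close>)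
    moreover have "m \<in> {(n, 0, 0, 0), (0, n, 0, 0), (n, 0, 0, 1), (0, n, 0, 1)} \<Longrightarrow>
        mon m * p \<in> supported L" for m
      using p by (rule supported_mon_mult) (use rees_expo_shift in \<open>fastforce simp: L_def\<close>)
    ultimately show "(?x + ?ty) * p \<in> supported L \<and> (param1 n - (?x + ?ty)) * p \<in> supported V"
      "(?y + ?tx) * p \<in> supported L \<and> (param2 n - (?y + ?tx)) * p \<in> supported V"
      by (auto simp: param1_def param2_def distrib_right intro!: supported_add)
  next
    fix a b :: "'k bpoly" assume b: "b \<in> supported L" and eq: "(?y + ?tx) * b = (?x + ?ty) * a"
    \<comment> \<open>Subtracts \<open>t\<close> times the first binomial from the second. As
      \<open>t\<close> is not in \<open>A\<close>, this happens in the full polynomial ring;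
      \<open>quotient_z0\<close> leads back to the layer.\<close>
    have "(?y - mon (0, n, 0, 2)) * b = (?y + ?tx) * b - mon (0, 0, 0, 1) * ((?x + ?ty) * b)"
      by (simp add: algebra_simps numeral_2_eq_2 flip: mon_add mult.assoc)
    also have "\<dots> = (?x + ?ty) * (a - mon (0, 0, 0, 1) * b)"
      unfolding eq by (simp add: algebra_simps)
    finally obtain c where c: "b = (?x + ?ty) * c"
      by (rule monic_dvd_x[OF n, rotated 3])
        (auto intro!: supported_mon supported_diff)
    then have "c \<in> supported L" using quotient_z0[OF n] b unfolding L_def by blast
    then show "\<exists>c\<in>supported L. b = (?x + ?ty) * c" using c by blast
  qed
  moreover have "L \<union> V = rees_expo n" by (auto simp: L_def V_def)
  ultimately show ?thesis by (simp add: V_def)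
qed

text \<open>The actions are \<open>x^n + z^n t\<close> and \<open>x^n t + z^n t\<close>. Eliminating
  \<open>x^n\<close> gives \<open>(t - t^2) z^n\<close>, again free of \<open>x\<close>.\<close>

lemma layer_y0:
  assumes n: "n > 0"
  shows "reg_pair (param1 n) (param2 n) (supported (rees_expo n \<inter> {(a, b, c, j). c > 0}))
    (supported (rees_expo n \<inter> {(a, b, c, j). b > 0 \<and> c > 0}) :: 'k::field bpoly set)"
proof -
  define L where "L = rees_expo n \<inter> {(a, b, c, j). b = 0 \<and> c > 0}"
  define V where "V = rees_expo n \<inter> {(a, b, c, j). b > 0 \<and> c > 0}"
  let ?x = "mon (n, 0, 0, 0) :: 'k bpoly" and ?tz = "mon (0, 0, n, 1) :: 'k bpoly"
  let ?tx = "mon (n, 0, 0, 1) :: 'k bpoly"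
  have "reg_pair (param1 n) (param2 n) (supported (L \<union> V) :: 'k bpoly set) (supported V)"
  proof (rule reg_pair_layer)
    show "L \<inter> V = {}" by (auto simp: L_def V_def)
    show "stable (param1 n) V" "stable (param2 n) V"
      unfolding V_def by (intro param_stable; use rees_expo_shift in fastforce)+
    show "?x + ?tz \<noteq> 0" using n by (simp add: mon_add_neq_0)
    fix p :: "'k bpoly" assume p: "p \<in> supported L"
    have "mon (0, n, 0, 0) * p \<in> supported V" "mon (0, n, 0, 1) * p \<in> supported V"
      using p by (auto intro!: supported_mon_mult[of p L])
        (use n rees_expo_shift in \<open>fastforce simp: L_def V_def\<close>)+
    moreover have "m \<in> {(n, 0, 0, 0), (n, 0, 0, 1), (0, 0, n, 1)} \<Longrightarrow>
        mon m * p \<in> supported L" for m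
      using p by (rule supported_mon_mult) (use rees_expo_shift in \<open>fastforce simp: L_def\<close>)
    ultimately show "(?x + ?tz) * p \<in> supported L \<and> (param1 n - (?x + ?tz)) * p \<in> supported V"
      "(?tx + ?tz) * p \<in> supported L \<and> (param2 n - (?tx + ?tz)) * p \<in> supported V"
      by (auto simp: param1_def param2_def distrib_right intro!: supported_add)
  next
    fix a b :: "'k bpoly" assume b: "b \<in> supported L" and eq: "(?tx + ?tz) * b = (?x + ?tz) * a"
    have "(mon (0, 0, n, 1) - mon (0, 0, n, 2)) * b = (?tx + ?tz) * b - mon (0, 0, 0, 1) * ((?x + ?tz) * b)"
      by (simp add: algebra_simps numeral_2_eq_2 flip: mon_add mult.assoc)
    also have "\<dots> = (?x + ?tz) * (a - mon (0, 0, 0, 1) * b)"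
      unfolding eq by (simp add: algebra_simps)
    finally obtain c where c: "b = (?x + ?tz) * c"
      by (rule monic_dvd_x[OF n, rotated 3])
        (auto intro!: supported_mon supported_diff)
    then have "c \<in> supported L" using quotient_y0[OF n] b unfolding L_def by blast
    then show "\<exists>c\<in>supported L. b = (?x + ?tz) * c" using c by blast
  qed
  moreover have "L \<union> V = rees_expo n \<inter> {(a, b, c, j). c > 0}" by (auto simp: L_def V_def)
  ultimately show ?thesis by (simp add: V_def)
qed

text \<open>The actions are \<open>y^n t + z^n t\<close> and \<open>y^n + z^n t\<close>. Now the
  second is the monic one, in \<open>y\<close>, so the roles are exchanged: first \<open>a\<close>
  is shown to be a multiple of it, then cancellation gives \<open>b\<close>.\<close>

lemma layer_x0:
  assumes n: "n > 0"
  shows "reg_pair (param1 n) (param2 n) (supported (rees_expo n \<inter> {(a, b, c, j). b > 0 \<and> c > 0}))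
    (supported (rees_expo n \<inter> {(a, b, c, j). a > 0 \<and> b > 0 \<and> c > 0}) :: 'k::field bpoly set)"
proof -
  define L where "L = rees_expo n \<inter> {(a, b, c, j). a = 0 \<and> b > 0 \<and> c > 0}"
  define V where "V = rees_expo n \<inter> {(a, b, c, j). a > 0 \<and> b > 0 \<and> c > 0}"
  let ?y = "mon (0, n, 0, 0) :: 'k bpoly" and ?tz = "mon (0, 0, n, 1) :: 'k bpoly"
  let ?ty = "mon (0, n, 0, 1) :: 'k bpoly"
  have "reg_pair (param1 n) (param2 n) (supported (L \<union> V) :: 'k bpoly set) (supported V)"
  proof (rule reg_pair_layer)
    show "L \<inter> V = {}" by (auto simp: L_def V_def)
    show "stable (param1 n) V" "stable (param2 n) V"
      unfolding V_def by (intro param_stable; use rees_expo_shift in fastforce)+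
    show "?ty + ?tz \<noteq> 0" using n by (simp add: mon_add_neq_0)
    fix p :: "'k bpoly" assume p: "p \<in> supported L"
    have "mon (n, 0, 0, 0) * p \<in> supported V" "mon (n, 0, 0, 1) * p \<in> supported V"
      using p by (auto intro!: supported_mon_mult[of p L])
        (use n rees_expo_shift in \<open>fastforce simp: L_def V_def\<close>)+
    moreover have "m \<in> {(0, n, 0, 0), (0, n, 0, 1), (0, 0, n, 1)} \<Longrightarrow>
        mon m * p \<in> supported L" for m
      using p by (rule supported_mon_mult) (use rees_expo_shift in \<open>fastforce simp: L_def\<close>)
    ultimately show "(?ty + ?tz) * p \<in> supported L \<and> (param1 n - (?ty + ?tz)) * p \<in> supported V"
      "(?y + ?tz) * p \<in> supported L \<and> (param2 n - (?y + ?tz)) * p \<in> supported V"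
      by (auto simp: param1_def param2_def distrib_right intro!: supported_add)
  next
    fix a b :: "'k bpoly" assume a: "a \<in> supported L" and eq: "(?y + ?tz) * b = (?ty + ?tz) * a"
    have "(mon (0, 0, n, 1) - mon (0, 0, n, 2)) * a = (?ty + ?tz) * a - mon (0, 0, 0, 1) * ((?y + ?tz) * a)"
      by (simp add: algebra_simps numeral_2_eq_2 flip: mon_add mult.assoc)
    also have "\<dots> = (?y + ?tz) * (b - mon (0, 0, 0, 1) * a)"
      unfolding eq[symmetric] by (simp add: algebra_simps)
    finally obtain c where c: "a = (?y + ?tz) * c"
      by (rule monic_dvd_y[OF n, rotated 3])
        (auto intro!: supported_mon supported_diff)
    then have "c \<in> supported L" using quotient_x0[OF n] a unfolding L_def by blast
    moreover have "(?y + ?tz) * b = (?y + ?tz) * ((?ty + ?tz) * c)"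
      using eq by (simp add: c mult_ac)
    then have "b = (?ty + ?tz) * c"
      using n mult_cancel_left mon_add_neq_0[of "(0, n, 0, 0)" "(0, 0, n, 1)"] by auto
    ultimately show "\<exists>c\<in>supported L. b = (?ty + ?tz) * c" by blast
  qed
  moreover have "L \<union> V = rees_expo n \<inter> {(a, b, c, j). b > 0 \<and> c > 0}" by (auto simp: L_def V_def)
  ultimately show ?thesis by (simp add: V_def)
qed

text \<open>Every term with a factor \<open>t\<close> leads out of \<open>j = 0\<close>, so
  \<open>g1\<close> and \<open>g2\<close> act as the coprime monomials \<open>x^n\<close> and
  \<open>y^n\<close>.\<close>

lemma layer_j0:
  assumes n: "n > 0"
  shows "reg_pair (param1 n) (param2 n)
    (supported (rees_expo n \<inter> {(a, b, c, j). a > 0 \<and> b > 0 \<and> c > 0}))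
    (supported (rees_expo n \<inter> {(a, b, c, j). a > 0 \<and> b > 0 \<and> c > 0 \<and> j > 0}) :: 'k::field bpoly set)"
proof -
  define L where "L = rees_expo n \<inter> {(a, b, c, j). a > 0 \<and> b > 0 \<and> c > 0 \<and> j = 0}"
  define V where "V = rees_expo n \<inter> {(a, b, c, j). a > 0 \<and> b > 0 \<and> c > 0 \<and> j > 0}"
  let ?x = "mon (n, 0, 0, 0) :: 'k bpoly" and ?y = "mon (0, n, 0, 0) :: 'k bpoly"
  have "reg_pair (param1 n) (param2 n) (supported (L \<union> V) :: 'k bpoly set) (supported V)"
  proof (rule reg_pair_layer)
    show "L \<inter> V = {}" by (auto simp: L_def V_def)
    show "stable (param1 n) V" "stable (param2 n) V"
      unfolding V_def by (intro param_stable; use rees_expo_shift in fastforce)+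
    show "?x \<noteq> 0" by simp
    fix p :: "'k bpoly" assume p: "p \<in> supported L"
    have "m \<in> {(n, 0, 0, 1), (0, n, 0, 1), (0, 0, n, 1)} \<Longrightarrow> mon m * p \<in> supported V" for m
      using p by (rule supported_mon_mult) (use rees_expo_shift in \<open>fastforce simp: L_def V_def\<close>)
    moreover have "m \<in> {(n, 0, 0, 0), (0, n, 0, 0)} \<Longrightarrow> mon m * p \<in> supported L" for m
      using p by (rule supported_mon_mult) (use rees_expo_shift in \<open>fastforce simp: L_def\<close>)
    ultimately show "?x * p \<in> supported L \<and> (param1 n - ?x) * p \<in> supported V"
      "?y * p \<in> supported L \<and> (param2 n - ?y) * p \<in> supported V"
      by (auto simp: param1_def param2_def distrib_right intro!: supported_add)
  next
    fix a b :: "'k bpoly" assume "a \<in> supported L" "b \<in> supported L" "?y * b = ?x * a"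
    then show "\<exists>c\<in>supported L. b = ?x * c"
    proof (rule mon_coprime)
      fix w w' assume "w \<in> L" "w' \<in> L" "w + (0, n, 0, 0) = w' + (n, 0, 0, 0)"
      \<comment> \<open>Since \<open>a = a' + n\<close> with \<open>a' > 0\<close>, dividing
        \<open>w\<close> by \<open>x^n\<close> keeps all three exponents positive, which is all that
        \<open>L\<close> asks for when \<open>j = 0\<close>.\<close>
      then obtain a b c a' b' c' where
        "w = (a, b, c, 0)" "w' = (a', b', c', 0)" "a = a' + n" "a' > 0" "b > 0" "c > 0"
        by (auto simp: L_def)
      then show "\<exists>v\<in>L. w = v + (n, 0, 0, 0)"
        by (intro bexI[of _ "(a', b, c, 0)"]) (auto simp: L_def rees_expo_0)
    qed
  qed
  moreover have "L \<union> V = rees_expo n \<inter> {(a, b, c, j). a > 0 \<and> b > 0 \<and> c > 0}"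
    by (auto simp: L_def V_def)
  ultimately show ?thesis by (simp add: V_def)
qed

section \<open>Regularity on the layers of corner monomials\<close>

lemma rees_expo_xyzt_add:
  assumes "w \<in> rees_expo_xyzt n" "m \<in> rees_expo n" shows "w + m \<in> rees_expo_xyzt n"
proof -
  obtain v where "v \<in> rees_expo n" "w = v + (1, 1, 1, 1)"
    using assms(1) unfolding rees_expo_xyzt_def by blast
  then have "v + m \<in> rees_expo n" "w + m = v + m + (1, 1, 1, 1)"
    using assms(2) by (simp_all add: rees_expo_add add_ac)
  then show ?thesis unfolding rees_expo_xyzt_def by blast
qed

lemma rees_expo_xyzt_shift:
  "w \<in> rees_expo_xyzt n \<Longrightarrow>
   m \<in> {(n, 0, 0, 0), (0, n, 0, 0), (n, 0, 0, 1), (0, n, 0, 1), (0, 0, n, 1)} \<Longrightarrow>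
   w + m \<in> rees_expo_xyzt n"
  using rees_expo_xyzt_add rees_expo_gens rees_expo_0 by blast

text \<open>An extra \<open>x^n\<close> or \<open>y^n\<close> without \<open>t\<close> lets the
  powers of \<open>t\<close> be redistributed so that \<open>xyzt\<close> splits off. The generator
  in the third variable, such as \<open>z^n t\<close> on \<open>corner_xy\<close>, completes
  \<open>x^n y^n z^n t^3 = (xyzt)^3 (xyz)^(n-3)\<close>.\<close>

lemma corner_shift_out:
  assumes n: "n \<ge> 3"
  shows "w \<in> corner_xy n \<Longrightarrow> m \<in> {(n, 0, 0, 0), (0, n, 0, 0), (0, 0, n, 1)} \<Longrightarrow>
      w + m \<in> rees_expo_xyzt n"
    and "w \<in> corner_xz n \<Longrightarrow> m \<in> {(n, 0, 0, 0), (0, n, 0, 0), (0, n, 0, 1)} \<Longrightarrow>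
      w + m \<in> rees_expo_xyzt n"
    and "w \<in> corner_yz n \<Longrightarrow> m \<in> {(n, 0, 0, 0), (0, n, 0, 0), (n, 0, 0, 1)} \<Longrightarrow>
      w + m \<in> rees_expo_xyzt n"
proof -
  have xyzt: "(a, b, c, j) \<in> rees_expo_xyzt n"
    if "j = m + p + q + r + 1" "m + n * p + 1 \<le> a" "m + n * q + 1 \<le> b" "m + n * r + 1 \<le> c"
    for a b c j m p q r
    using that rees_expo_intro[of "j - 1" m p q r n "a - 1" "b - 1" "c - 1"]
    by (simp add: rees_expo_xyzt_iff)
  show "w + m \<in> rees_expo_xyzt n"
    if w: "w \<in> corner_xy n" and m: "m \<in> {(n, 0, 0, 0), (0, n, 0, 0), (0, 0, n, 1)}"
  proof -
    obtain p q where "w = (n * Suc p, n * Suc q, 1, Suc p + Suc q)"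
      using w unfolding corner_xy_def by clarify (metis gr0_implies_Suc)
    then show ?thesis
      using m n xyzt[of _ 0 "p + 1" q 0] xyzt[of _ 0 p "q + 1" 0] xyzt[of _ 2 p q 0] by auto
  qed
  show "w + m \<in> rees_expo_xyzt n"
    if w: "w \<in> corner_xz n" and m: "m \<in> {(n, 0, 0, 0), (0, n, 0, 0), (0, n, 0, 1)}"
  proof -
    obtain p q where "w = (n * Suc p, 1, n * Suc q, Suc p + Suc q)"
      using w unfolding corner_xz_def by clarify (metis gr0_implies_Suc)
    then show ?thesis
      using m n xyzt[of _ 0 "p + 1" 0 q] xyzt[of _ 0 p 1 q] xyzt[of _ 2 p 0 q] by auto
  qed
  show "w + m \<in> rees_expo_xyzt n"
    if w: "w \<in> corner_yz n" and m: "m \<in> {(n, 0, 0, 0), (0, n, 0, 0), (n, 0, 0, 1)}"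
  proof -
    obtain p q where "w = (1, n * Suc p, n * Suc q, Suc p + Suc q)"
      using w unfolding corner_yz_def by clarify (metis gr0_implies_Suc)
    then show ?thesis
      using m n xyzt[of _ 0 1 p q] xyzt[of _ 0 0 "p + 1" q] xyzt[of _ 2 0 p q] by auto
  qed
qed

lemma corner_shift_in:
  shows "w \<in> corner_xy n \<Longrightarrow> m \<in> {(n, 0, 0, 1), (0, n, 0, 1)} \<Longrightarrow> w + m \<in> corner_xy n"
    and "w \<in> corner_xz n \<Longrightarrow> m \<in> {(n, 0, 0, 1), (0, 0, n, 1)} \<Longrightarrow> w + m \<in> corner_xz n"
    and "w \<in> corner_yz n \<Longrightarrow> m \<in> {(0, n, 0, 1), (0, 0, n, 1)} \<Longrightarrow> w + m \<in> corner_yz n"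
proof -
  have corner: "(n * p, n * q, 1, p + q) \<in> corner_xy n" "(n * p, 1, n * q, p + q) \<in> corner_xz n"
    "(1, n * p, n * q, p + q) \<in> corner_yz n" if "p > 0" "q > 0" for p q
    using that unfolding corner_xy_def corner_xz_def corner_yz_def by blast+
  show "w + m \<in> corner_xy n" if w: "w \<in> corner_xy n" and m: "m \<in> {(n, 0, 0, 1), (0, n, 0, 1)}"
  proof -
    obtain p q where pq: "w = (n * p, n * q, 1, p + q)" "p > 0" "q > 0"
      using w unfolding corner_xy_def by blast
    then show ?thesis
      using m corner(1)[of "p + 1" q] corner(1)[of p "q + 1"] by (auto simp: algebra_simps)
  qed
  show "w + m \<in> corner_xz n" if w: "w \<in> corner_xz n" and m: "m \<in> {(n, 0, 0, 1), (0, 0, n, 1)}"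
  proof -
    obtain p q where pq: "w = (n * p, 1, n * q, p + q)" "p > 0" "q > 0"
      using w unfolding corner_xz_def by blast
    then show ?thesis
      using m corner(2)[of "p + 1" q] corner(2)[of p "q + 1"] by (auto simp: algebra_simps)
  qed
  show "w + m \<in> corner_yz n" if w: "w \<in> corner_yz n" and m: "m \<in> {(0, n, 0, 1), (0, 0, n, 1)}"
  proof -
    obtain p q where pq: "w = (1, n * p, n * q, p + q)" "p > 0" "q > 0"
      using w unfolding corner_yz_def by blast
    then show ?thesis
      using m corner(3)[of "p + 1" q] corner(3)[of p "q + 1"] by (auto simp: algebra_simps)
  qed
qed

text \<open>A term of \<open>g1\<close> or \<open>g2\<close> sends each corner family into itself or
  into \<open>rees_expo_xyzt\<close>, never into another family, so stacking the families gives
  submodules.\<close>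

lemma stable_lower:
  assumes n: "n \<ge> 3"
    and m: "m \<in> {(n, 0, 0, 0), (0, n, 0, 0), (n, 0, 0, 1), (0, n, 0, 1), (0, 0, n, 1)}"
  shows "w \<in> rees_expo_xyzt n \<Longrightarrow> w + m \<in> rees_expo_xyzt n"
    and "w \<in> corner_yz n \<union> rees_expo_xyzt n \<Longrightarrow> w + m \<in> corner_yz n \<union> rees_expo_xyzt n"
    and "w \<in> corner_xz n \<union> (corner_yz n \<union> rees_expo_xyzt n) \<Longrightarrow>
      w + m \<in> corner_xz n \<union> (corner_yz n \<union> rees_expo_xyzt n)"
proof -
  show T: "w \<in> rees_expo_xyzt n \<Longrightarrow> w + m \<in> rees_expo_xyzt n"
    using m by (rule rees_expo_xyzt_shift[rotated])
  have yz: "w + m \<in> corner_yz n \<union> rees_expo_xyzt n" if "w \<in> corner_yz n"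
    using m corner_shift_out(3)[OF n that, of m] corner_shift_in(3)[OF that, of m] by blast
  have xz: "w + m \<in> corner_xz n \<union> rees_expo_xyzt n" if "w \<in> corner_xz n"
    using m corner_shift_out(2)[OF n that, of m] corner_shift_in(2)[OF that, of m] by blast
  show "w \<in> corner_yz n \<union> rees_expo_xyzt n \<Longrightarrow> w + m \<in> corner_yz n \<union> rees_expo_xyzt n"
    using T yz by blast
  show "w \<in> corner_xz n \<union> (corner_yz n \<union> rees_expo_xyzt n) \<Longrightarrow>
      w + m \<in> corner_xz n \<union> (corner_yz n \<union> rees_expo_xyzt n)"
    using T yz xz by blast
qed

text \<open>The layer is free of rank one over \<open>k[x^n t, y^n t]\<close>, generated by
  \<open>z x^n y^n t^2\<close>, and \<open>g1\<close> and \<open>g2\<close> act as the variables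
  \<open>y^n t\<close> and \<open>x^n t\<close>.\<close>

lemma layer_corner_xy:
  assumes n: "n \<ge> 3"
  shows "reg_pair (param1 n) (param2 n)
    (supported (corner_xy n \<union> (corner_xz n \<union> (corner_yz n \<union> rees_expo_xyzt n))))
    (supported (corner_xz n \<union> (corner_yz n \<union> rees_expo_xyzt n)) :: 'k::field bpoly set)"
proof -
  define L where "L = corner_xy n"
  define V where "V = corner_xz n \<union> (corner_yz n \<union> rees_expo_xyzt n)"
  let ?tx = "mon (n, 0, 0, 1) :: 'k bpoly" and ?ty = "mon (0, n, 0, 1) :: 'k bpoly"
  have corner: "\<exists>v\<in>L. w = v + (0, n, 0, 1)" if "w \<in> L" "w' \<in> L" "w + (n, 0, 0, 1) = w' + (0, n, 0, 1)" for w w'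
  proof -
    obtain p q p' q' where "w = (n * p, n * q, 1, p + q)" "w' = (n * p', n * q', 1, p' + q')"
      and pos: "p > 0" "q > 0" "p' > 0" "q' > 0"
      using \<open>w \<in> L\<close> \<open>w' \<in> L\<close> unfolding L_def corner_xy_def by blast
    moreover from this have "n * q = n * (q' + 1)" using that(3) by simp
    then have "q = q' + 1" using n by (metis mult_left_cancel not_numeral_le_zero)
    \<comment> \<open>Since \<open>q' > 0\<close>, the quotient by \<open>y^n t\<close> is still in
      the family.\<close>
    ultimately show ?thesis
      by (intro bexI[of _ "(n * p, n * q', 1, p + q')"]) (auto simp: L_def corner_xy_def algebra_simps)
  qed
  have "reg_pair (param1 n) (param2 n) (supported (L \<union> V) :: 'k bpoly set) (supported V)"
  proof (rule reg_pair_layer)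
    show "L \<inter> V = {}" using corner_disjoint[OF n] by (auto simp: L_def V_def)
    show "stable (param1 n) V" "stable (param2 n) V"
      unfolding V_def by (rule param_stable; rule stable_lower[OF n]; assumption)+
    show "?ty \<noteq> 0" by simp
    fix p :: "'k bpoly" assume p: "p \<in> supported L"
    have "m \<in> {(n, 0, 0, 0), (0, n, 0, 0), (0, 0, n, 1)} \<Longrightarrow> mon m * p \<in> supported V" for m
      using p by (rule supported_mon_mult) (use corner_shift_out(1)[OF n] in \<open>auto simp: L_def V_def\<close>)
    moreover have "m \<in> {(n, 0, 0, 1), (0, n, 0, 1)} \<Longrightarrow> mon m * p \<in> supported L" for m
      using p by (rule supported_mon_mult) (use corner_shift_in(1) in \<open>auto simp: L_def\<close>)
    ultimately show "(?ty) * p \<in> supported L \<and> (param1 n - (?ty)) * p \<in> supported V"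
      "(?tx) * p \<in> supported L \<and> (param2 n - (?tx)) * p \<in> supported V"
      by (auto simp: param1_def param2_def distrib_right intro!: supported_add)
  next
    fix a b :: "'k bpoly" assume "a \<in> supported L" "b \<in> supported L" "?tx * b = ?ty * a"
    then show "\<exists>c\<in>supported L. b = ?ty * c"
      by (rule mon_coprime) (rule corner)
  qed
  then show ?thesis by (simp add: L_def V_def)
qed

lemma layer_corner_xz:
  assumes n: "n \<ge> 3"
  shows "reg_pair (param1 n) (param2 n) (supported (corner_xz n \<union> (corner_yz n \<union> rees_expo_xyzt n)))
    (supported (corner_yz n \<union> rees_expo_xyzt n) :: 'k::field bpoly set)"
proof -
  define L where "L = corner_xz n"
  define V where "V = corner_yz n \<union> rees_expo_xyzt n"
  let ?tx = "mon (n, 0, 0, 1) :: 'k bpoly" and ?tz = "mon (0, 0, n, 1) :: 'k bpoly"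
  have corner: "\<exists>v\<in>L. w = v + (0, 0, n, 1)" if "w \<in> L" "w' \<in> L" "w + (n, 0, 0, 1) = w' + (0, 0, n, 1)" for w w'
  proof -
    obtain p q p' q' where "w = (n * p, 1, n * q, p + q)" "w' = (n * p', 1, n * q', p' + q')"
      and pos: "p > 0" "q > 0" "p' > 0" "q' > 0"
      using \<open>w \<in> L\<close> \<open>w' \<in> L\<close> unfolding L_def corner_xz_def by blast
    moreover from this have "n * q = n * (q' + 1)" using that(3) by simp
    then have "q = q' + 1" using n by (metis mult_left_cancel not_numeral_le_zero)
    ultimately show ?thesis
      by (intro bexI[of _ "(n * p, 1, n * q', p + q')"]) (auto simp: L_def corner_xz_def algebra_simps)
  qed
  have "reg_pair (param1 n) (param2 n) (supported (L \<union> V) :: 'k bpoly set) (supported V)"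
  proof (rule reg_pair_layer)
    show "L \<inter> V = {}" using corner_disjoint[OF n] by (auto simp: L_def V_def)
    show "stable (param1 n) V" "stable (param2 n) V"
      unfolding V_def by (rule param_stable; rule stable_lower[OF n]; assumption)+
    show "?tz \<noteq> 0" by simp
    fix p :: "'k bpoly" assume p: "p \<in> supported L"
    have "m \<in> {(n, 0, 0, 0), (0, n, 0, 0), (0, n, 0, 1)} \<Longrightarrow> mon m * p \<in> supported V" for m
      using p by (rule supported_mon_mult) (use corner_shift_out(2)[OF n] in \<open>auto simp: L_def V_def\<close>)
    moreover have "m \<in> {(n, 0, 0, 1), (0, 0, n, 1)} \<Longrightarrow> mon m * p \<in> supported L" for m
      using p by (rule supported_mon_mult) (use corner_shift_in(2) in \<open>auto simp: L_def\<close>)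
    ultimately show "(?tz) * p \<in> supported L \<and> (param1 n - (?tz)) * p \<in> supported V"
      "(?tx + ?tz) * p \<in> supported L \<and> (param2 n - (?tx + ?tz)) * p \<in> supported V"
      by (auto simp: param1_def param2_def distrib_right intro!: supported_add)
  next
    fix a b :: "'k bpoly" assume "a \<in> supported L" "b \<in> supported L" "(?tx + ?tz) * b = ?tz * a"
    \<comment> \<open>Moving \<open>z^n t b\<close> to the right leaves a relation between single
      monomials, with \<open>a - b\<close> in place of \<open>a\<close>.\<close>
    then have "a - b \<in> supported L" "b \<in> supported L" "?tx * b = ?tz * (a - b)"
      by (simp_all add: supported_diff algebra_simps)
    then show "\<exists>c\<in>supported L. b = ?tz * c"
      by (rule mon_coprime) (rule corner)
  qed
  then show ?thesis by (simp add: L_def V_def)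
qed

lemma layer_corner_yz:
  assumes n: "n \<ge> 3"
  shows "reg_pair (param1 n) (param2 n) (supported (corner_yz n \<union> (rees_expo_xyzt n)))
    (supported (rees_expo_xyzt n) :: 'k::field bpoly set)"
proof -
  define L where "L = corner_yz n"
  define V where "V = rees_expo_xyzt n"
  let ?ty = "mon (0, n, 0, 1) :: 'k bpoly" and ?tz = "mon (0, 0, n, 1) :: 'k bpoly"
  have corner: "\<exists>v\<in>L. w = v + (0, 0, n, 1)" if "w \<in> L" "w' \<in> L" "w + (0, n, 0, 1) = w' + (0, 0, n, 1)" for w w'
  proof -
    obtain p q p' q' where "w = (1, n * p, n * q, p + q)" "w' = (1, n * p', n * q', p' + q')"
      and pos: "p > 0" "q > 0" "p' > 0" "q' > 0"
      using \<open>w \<in> L\<close> \<open>w' \<in> L\<close> unfolding L_def corner_yz_def by blast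
    moreover from this have "n * q = n * (q' + 1)" using that(3) by simp
    then have "q = q' + 1" using n by (metis mult_left_cancel not_numeral_le_zero)
    ultimately show ?thesis
      by (intro bexI[of _ "(1, n * p, n * q', p + q')"]) (auto simp: L_def corner_yz_def algebra_simps)
  qed
  have "reg_pair (param1 n) (param2 n) (supported (L \<union> V) :: 'k bpoly set) (supported V)"
  proof (rule reg_pair_layer)
    show "L \<inter> V = {}" using corner_disjoint[OF n] by (auto simp: L_def V_def)
    show "stable (param1 n) V" "stable (param2 n) V"
      unfolding V_def by (rule param_stable; rule stable_lower[OF n]; assumption)+
    show "?ty + ?tz \<noteq> 0" using n by (simp add: mon_add_neq_0)
    fix p :: "'k bpoly" assume p: "p \<in> supported L"
    have "m \<in> {(n, 0, 0, 0), (0, n, 0, 0), (n, 0, 0, 1)} \<Longrightarrow> mon m * p \<in> supported V" for m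
      using p by (rule supported_mon_mult) (use corner_shift_out(3)[OF n] in \<open>auto simp: L_def V_def\<close>)
    moreover have "m \<in> {(0, n, 0, 1), (0, 0, n, 1)} \<Longrightarrow> mon m * p \<in> supported L" for m
      using p by (rule supported_mon_mult) (use corner_shift_in(3) in \<open>auto simp: L_def\<close>)
    ultimately show "(?ty + ?tz) * p \<in> supported L \<and> (param1 n - (?ty + ?tz)) * p \<in> supported V"
      "(?tz) * p \<in> supported L \<and> (param2 n - (?tz)) * p \<in> supported V"
      by (auto simp: param1_def param2_def distrib_right intro!: supported_add)
  next
    fix a b :: "'k bpoly" assume "a \<in> supported L" "b \<in> supported L" "?tz * b = (?ty + ?tz) * a"
    \<comment> \<open>Subtracting \<open>z^n t a\<close> leaves a relation between single monomials.
      It makes \<open>a\<close> a multiple of \<open>z^n t\<close>, and cancelling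
      \<open>z^n t\<close> then determines \<open>b\<close>.\<close>
    then have ab: "b - a \<in> supported L" "a \<in> supported L" "?ty * a = ?tz * (b - a)"
      by (simp_all add: supported_diff algebra_simps)
    then have "\<exists>c\<in>supported L. a = ?tz * c"
      by (rule mon_coprime) (rule corner)
    then obtain c where c: "c \<in> supported L" "a = ?tz * c" by blast
    have "?tz * (b - a) = ?tz * (?ty * c)" using ab(3) by (simp add: c(2) mult_ac)
    then have "b - a = ?ty * c" by simp
    then have "b = (?ty + ?tz) * c" by (simp add: c(2) algebra_simps)
    then show "\<exists>c\<in>supported L. b = (?ty + ?tz) * c" using c(1) by blast
  qed
  then show ?thesis by (simp add: L_def V_def)
qed

text \<open>The chain from \<open>rees_expo n\<close> through \<open>U1\<close>, ...,
  \<open>U6\<close> down to \<open>rees_expo_xyzt n\<close> has the seven layers above as successive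
  quotients; \<open>reg_pair_trans\<close> joins them from the bottom upwards.\<close>

lemma reg_pair_xyzt:
  assumes n: "n \<ge> 3"
  shows "reg_pair (param1 n) (param2 n) (supported (rees_expo n))
    (supported (rees_expo_xyzt n) :: 'k::field bpoly set)"
proof -
  define U1 where "U1 = rees_expo n \<inter> {(a, b, c, j). c > 0}"
  define U2 where "U2 = rees_expo n \<inter> {(a, b, c, j). b > 0 \<and> c > 0}"
  define U3 where "U3 = rees_expo n \<inter> {(a, b, c, j). a > 0 \<and> b > 0 \<and> c > 0}"
  define U4 where "U4 = rees_expo n \<inter> {(a, b, c, j). a > 0 \<and> b > 0 \<and> c > 0 \<and> j > 0}"
  define U6 where "U6 = corner_yz n \<union> rees_expo_xyzt n"
  define U5 where "U5 = corner_xz n \<union> U6"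
  have n0: "n > 0" using n by simp
  have T: "rees_expo_xyzt n \<subseteq> U4"
  proof
    fix w assume w: "w \<in> rees_expo_xyzt n"
    then obtain v where v: "v \<in> rees_expo n" "w = v + (1, 1, 1, 1)"
      unfolding rees_expo_xyzt_def by blast
    then have "w \<in> rees_expo n" using rees_expo_add rees_expo_gens(4) by blast
    then show "w \<in> U4" using v by (cases v) (auto simp: U4_def)
  qed
  have "w \<in> U4" if "w \<in> rees_expo n" "w \<in> corner_xy n \<union> corner_xz n \<union> corner_yz n" for w
    using that n0 unfolding U4_def corner_xy_def corner_xz_def corner_yz_def by (elim UnE) auto
  then have corners: "corner_xy n \<subseteq> U4" "corner_xz n \<subseteq> U4" "corner_yz n \<subseteq> U4"
    using corner_subset[of n] by blast+
  \<comment> \<open>By \<open>corner_cases\<close>, monomials of \<open>A\<close> with all exponents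
    positive are corners or multiples of \<open>xyzt\<close>.\<close>
  have U4: "U4 = corner_xy n \<union> U5"
  proof
    show "U4 \<subseteq> corner_xy n \<union> U5"
      using corner_cases[OF n] unfolding U4_def U5_def U6_def by fast
    show "corner_xy n \<union> U5 \<subseteq> U4" using T corners unfolding U5_def U6_def by blast
  qed
  have stab: "stable (param2 n :: 'k bpoly) (rees_expo n)"
    by (intro param_stable; use rees_expo_shift in fastforce)
  have stab1: "stable (param2 n :: 'k bpoly) U1"
    unfolding U1_def by (intro param_stable; use rees_expo_shift in fastforce)
  have stab2: "stable (param2 n :: 'k bpoly) U2"
    unfolding U2_def by (intro param_stable; use rees_expo_shift in fastforce)
  have stab3: "stable (param2 n :: 'k bpoly) U3"
    unfolding U3_def by (intro param_stable; use rees_expo_shift in fastforce)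
  have stab4: "stable (param2 n :: 'k bpoly) U4"
    unfolding U4_def by (intro param_stable; use rees_expo_shift in fastforce)
  have stab5: "stable (param2 n :: 'k bpoly) U5"
    unfolding U5_def U6_def by (rule param_stable; rule stable_lower[OF n]; assumption)
  have stab6: "stable (param2 n :: 'k bpoly) U6"
    unfolding U6_def by (rule param_stable; rule stable_lower[OF n]; assumption)
  have "U1 \<subseteq> rees_expo n" "U2 \<subseteq> U1" "U3 \<subseteq> U2" "U4 \<subseteq> U3"
    unfolding U1_def U2_def U3_def U4_def by auto
  moreover have "U5 \<subseteq> U4" "U6 \<subseteq> U5" "rees_expo_xyzt n \<subseteq> U6"
    using U4 unfolding U5_def U6_def by blast+
  ultimately have sub: "U1 \<subseteq> rees_expo n" "U2 \<subseteq> U1" "U3 \<subseteq> U2" "U4 \<subseteq> U3"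
    "U5 \<subseteq> U4" "U6 \<subseteq> U5" "rees_expo_xyzt n \<subseteq> U6" by simp_all
  let ?T = "supported (rees_expo_xyzt n) :: 'k bpoly set"
  have "reg_pair (param1 n) (param2 n) (supported U6) ?T"
    using layer_corner_yz[OF n] unfolding U6_def .
  then have "reg_pair (param1 n) (param2 n) (supported U5) ?T"
    by (rule reg_pair_trans[OF layer_corner_xz[OF n, folded U6_def U5_def] _ sub(7) sub(6) stab5 stab6])
  then have "reg_pair (param1 n) (param2 n) (supported U4) ?T"
    by (rule reg_pair_trans[OF layer_corner_xy[OF n, folded U6_def, folded U5_def, folded U4]
          _ order_trans[OF sub(7,6)] sub(5) stab4 stab5])
  then have "reg_pair (param1 n) (param2 n) (supported U3) ?T"
    by (rule reg_pair_trans[OF layer_j0[OF n0, folded U3_def U4_def] _ T sub(4) stab3 stab4])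
  then have "reg_pair (param1 n) (param2 n) (supported U2) ?T"
    by (rule reg_pair_trans[OF layer_x0[OF n0, folded U2_def U3_def] _ order_trans[OF T sub(4)]
          sub(3) stab2 stab3])
  then have "reg_pair (param1 n) (param2 n) (supported U1) ?T"
    by (rule reg_pair_trans[OF layer_y0[OF n0, folded U1_def U2_def]
          _ order_trans[OF order_trans[OF T sub(4)] sub(3)] sub(2) stab1 stab2])
  then show ?thesis
    by (rule reg_pair_trans[OF layer_z0[OF n0, folded U1_def]
          _ order_trans[OF order_trans[OF order_trans[OF T sub(4)] sub(3)] sub(2)] sub(1) stab stab1])
qed

section \<open>The Rees algebra as a monomial subring\<close>

lemma ring_of_type_algebra_simps [simp]:
  "carrier ring_of_type_algebra = UNIV"
  "x \<otimes>\<^bsub>ring_of_type_algebra\<^esub> y = x * y" "x \<oplus>\<^bsub>ring_of_type_algebra\<^esub> y = x + y"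
  "\<one>\<^bsub>ring_of_type_algebra\<^esub> = 1" "\<zero>\<^bsub>ring_of_type_algebra\<^esub> = 0"
  by (simp_all add: ring_of_type_algebra_def)

text \<open>Additive inverses are multiples by \<ominus> \<one>, so closure under sums and one-sided
  multiples is enough.\<close>

lemma (in cring) idealI_mult:
  assumes "J \<subseteq> carrier R" "\<zero> \<in> J"
    and add: "\<And>a b. a \<in> J \<Longrightarrow> b \<in> J \<Longrightarrow> a \<oplus> b \<in> J"
    and mult: "\<And>x a. x \<in> carrier R \<Longrightarrow> a \<in> J \<Longrightarrow> x \<otimes> a \<in> J"
  shows "ideal J R"
proof (rule idealI)
  show "subgroup J (add_monoid R)"
  proof (rule add.subgroupI)
    fix a assume a: "a \<in> J"
    have "\<ominus> a = (\<ominus> \<one>) \<otimes> a" using a assms(1) l_minus by force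
    then show "\<ominus> a \<in> J" using mult[OF _ a, of "\<ominus> \<one>"] by simp
  qed (use assms in auto)
  show "ring R" by (rule ring_axioms)
  show "a \<otimes> x \<in> J" if "a \<in> J" "x \<in> carrier R" for a x
    using that assms(1) mult m_comm by (metis subsetD)
qed (rule mult)

text \<open>The candidate for \<open>I^j\<close>, described by exponents. Placing \<open>f\<close>
  in degree \<open>j\<close> with respect to \<open>t\<close> makes the facts about
  \<open>supported\<close> applicable.\<close>

definition level :: "nat \<Rightarrow> nat \<Rightarrow> (3, 'k::field) mpoly set" where
  "level n j = {f. Polynomial.monom f j \<in> supported (rees_expo n)}"

lemma cf_monom:
  "cf (Polynomial.monom f j) (a, b, c, i) =
    (if i = j then Poly_Mapping.lookup f (expv a b c) else 0)"
  by (simp add: cf.simps)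

lemma supported_iff_level:
  "p \<in> supported (rees_expo n) \<longleftrightarrow> (\<forall>j. Polynomial.coeff p j \<in> level n j)"
  unfolding supported_def level_def mem_Collect_eq split_paired_All cf_monom by (auto simp: cf.simps)

lemma level_mult:
  assumes "f \<in> level n i" "g \<in> level n j" shows "f * g \<in> level n (i + j)"
proof -
  have "Polynomial.monom f i * Polynomial.monom g j \<in> supported (rees_expo n)"
    using assms unfolding level_def by (intro supported_mult[of _ _ _ "rees_expo n"] rees_expo_add) auto
  then show ?thesis by (simp add: level_def mult_monom)
qed

lemma level_0 [simp]: "level n 0 = UNIV"
  unfolding level_def supported_def mem_Collect_eq split_paired_All cf_monom
  using rees_expo_0 by auto

lemma level_add: "f \<in> level n j \<Longrightarrow> g \<in> level n j \<Longrightarrow> f + g \<in> level n j"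
  by (simp add: level_def supported_add flip: add_monom)

lemma level_ideal: "ideal (level n j) ring_of_type_algebra"
proof -
  interpret cring "ring_of_type_algebra :: (3, 'k::field) mpoly ring" by (rule cring_from_type_algebra)
  show "ideal (level n j :: (3, 'k) mpoly set) ring_of_type_algebra"
  proof (rule idealI_mult)
    fix x a :: "(3, 'k) mpoly" assume "a \<in> level n j"
    then show "x \<otimes>\<^bsub>ring_of_type_algebra\<^esub> a \<in> level n j" using level_mult[of x n 0 a j] by simp
  qed (use level_add in \<open>auto simp: level_def\<close>)
qed

section \<open>Powers of the ideal and their monomials\<close>

lemma var_power: "var i ^ a = (Poly_Mapping.single (Poly_Mapping.single i a) 1 :: ('v, 'k::field) mpoly)"
  by (induction a) (simp_all add: var_def mult_single single_add[symmetric])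

lemma mon_ideal_generators:
  "{var 0 ^ n, var 1 ^ n, var 2 ^ n, var 0 ^ 1 * var 1 ^ 1 * var 2 ^ 1 :: (3, 'k::field) mpoly} =
   {Poly_Mapping.single (expv n 0 0) 1, Poly_Mapping.single (expv 0 n 0) 1,
    Poly_Mapping.single (expv 0 0 n) 1, Poly_Mapping.single (expv 1 1 1) 1}"
  unfolding var_power by (simp add: mult_single expv_def)

definition xyz_ideal :: "nat \<Rightarrow> (3, 'k::field) mpoly set" where
  "xyz_ideal n = mon_ideal n n n 1 1 1"

lemma mon_ideal_ideal: "ideal (xyz_ideal n :: (3, 'k::field) mpoly set) ring_of_type_algebra"
  unfolding xyz_ideal_def mon_ideal_def by (intro ring.genideal_ideal ring_from_type_algebra) simp

lemma single_in_mon_ideal: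
  "Poly_Mapping.single (expv n 0 0) 1 \<in> xyz_ideal n" "Poly_Mapping.single (expv 0 n 0) 1 \<in> xyz_ideal n"
  "Poly_Mapping.single (expv 0 0 n) 1 \<in> xyz_ideal n" "Poly_Mapping.single (expv 1 1 1) 1 \<in> xyz_ideal n"
  using ring.genideal_self[OF ring_from_type_algebra, of
      "{var 0 ^ n, var 1 ^ n, var 2 ^ n, var 0 ^ 1 * var 1 ^ 1 * var 2 ^ 1 :: (3, 'k::field) mpoly}"]
  unfolding xyz_ideal_def mon_ideal_def mon_ideal_generators by auto

lemma monom_single: "Polynomial.monom (Poly_Mapping.single (expv a b c) 1) j = mon (a, b, c, j)"
  by (simp add: mon.simps)

lemma mon_ideal_subset_level: "xyz_ideal n \<subseteq> level n 1"
  unfolding xyz_ideal_def mon_ideal_def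
proof (rule ring.genideal_minimal[OF ring_from_type_algebra level_ideal])
  show "{var 0 ^ n, var 1 ^ n, var 2 ^ n, var 0 ^ 1 * var 1 ^ 1 * var 2 ^ 1 :: (3, 'k::field) mpoly} \<subseteq> level n 1"
    unfolding mon_ideal_generators using rees_expo_gens[of n]
    by (simp add: level_def monom_single supported_mon)
qed

lemma ideal_pow_Suc:
  "I [^]\<^bsub>ideals_set R\<^esub> Suc j = ideal_prod R (I [^]\<^bsub>ideals_set R\<^esub> j) I"
  "I [^]\<^bsub>ideals_set R\<^esub> (0::nat) = carrier R"
  by (simp_all add: nat_pow_def ideals_set_def)

lemma pow_ideal: "ideal (xyz_ideal n [^]\<^bsub>ideals_set ring_of_type_algebra\<^esub> (j::nat))
  (ring_of_type_algebra :: (3, 'k::field) mpoly ring)"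
proof (induction j)
  case 0
  show ?case using ring.oneideal[OF ring_from_type_algebra] by (simp only: ideal_pow_Suc)
next
  case (Suc j)
  then show ?case
    unfolding ideal_pow_Suc by (intro ring.ideal_prod_is_ideal ring_from_type_algebra mon_ideal_ideal)
qed

lemma pow_subset_level:
  "(xyz_ideal n :: (3, 'k::field) mpoly set) [^]\<^bsub>ideals_set ring_of_type_algebra\<^esub> (j::nat) \<subseteq> level n j"
proof (induction j)
  case (Suc j)
  show ?case
  proof
    fix f :: "(3, 'k) mpoly"
    assume "f \<in> xyz_ideal n [^]\<^bsub>ideals_set ring_of_type_algebra\<^esub> Suc j"
    then show "f \<in> level n (Suc j)"
      unfolding ideal_pow_Suc
    proof (induction rule: ideal_prod.induct)
      case (prod f g)
      then have "f \<in> level n j" "g \<in> level n 1"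
        using Suc mon_ideal_subset_level by blast+
      then show ?case using level_mult[of f n j g 1] by simp
    qed (simp add: level_add)
  qed
qed simp

text \<open>In degree \<open>Suc j\<close> one of the counts \<open>m\<close>, \<open>p\<close>,
  \<open>q\<close>, \<open>r\<close> is positive. The corresponding generator splits off, and the
  cofactor, which carries the scalar \<open>k\<close>, lies in the previous power.\<close>

lemma single_in_pow:
  fixes k :: "'k::field"
  shows "(a, b, c, j) \<in> rees_expo n \<Longrightarrow>
   Poly_Mapping.single (expv a b c) k \<in> xyz_ideal n [^]\<^bsub>ideals_set ring_of_type_algebra\<^esub> j"
proof (induction j arbitrary: a b c)
  case 0
  show ?case by (simp only: ideal_pow_Suc ring_of_type_algebra_simps UNIV_I)
next
  case (Suc j)
  then obtain m p q r where j: "Suc j = m + p + q + r"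
    and le: "m + n * p \<le> a" "m + n * q \<le> b" "m + n * r \<le> c"
    unfolding rees_expo_def by auto
  have *: "Poly_Mapping.single (expv a b c) k \<in> xyz_ideal n [^]\<^bsub>ideals_set ring_of_type_algebra\<^esub> Suc j"
    if g: "Poly_Mapping.single (expv a' b' c') 1 \<in> (xyz_ideal n :: (3, 'k) mpoly set)" "a' \<le> a" "b' \<le> b" "c' \<le> c"
      and S: "(a - a', b - b', c - c', j) \<in> rees_expo n" for a' b' c'
  proof -
    have "Poly_Mapping.single (expv (a - a') (b - b') (c - c')) k \<otimes>\<^bsub>ring_of_type_algebra\<^esub>
        Poly_Mapping.single (expv a' b' c') 1 \<in> xyz_ideal n [^]\<^bsub>ideals_set ring_of_type_algebra\<^esub> Suc j"
      unfolding ideal_pow_Suc using Suc.IH[OF S] g(1) by (rule ideal_prod.prod)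
    then show ?thesis using g by (simp add: mult_single expv_add)
  qed
  consider m' where "m = Suc m'" | p' where "p = Suc p'" | q' where "q = Suc q'" | r' where "r = Suc r'"
    using j by (metis add_is_0 not0_implies_Suc nat.distinct(1))
  then show ?case
  proof cases
    case 1
    then show ?thesis
      using le j by (intro *[OF single_in_mon_ideal(4)] rees_expo_intro[of _ m' p q r]) auto
  next
    case 2
    then show ?thesis
      using le j by (intro *[OF single_in_mon_ideal(1)] rees_expo_intro[of _ m p' q r]) auto
  next
    case 3
    then show ?thesis
      using le j by (intro *[OF single_in_mon_ideal(2)] rees_expo_intro[of _ m p q' r]) auto
  next
    case 4
    then show ?thesis
      using le j by (intro *[OF single_in_mon_ideal(3)] rees_expo_intro[of _ m p q r']) auto
  qed
qed

lemma coeff_in_pow: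
  fixes p :: "'k::field bpoly"
  assumes "p \<in> supported (rees_expo n)"
  shows "Polynomial.coeff p j \<in> xyz_ideal n [^]\<^bsub>ideals_set ring_of_type_algebra\<^esub> j"
proof -
  let ?P = "xyz_ideal n [^]\<^bsub>ideals_set ring_of_type_algebra\<^esub> j :: (3, 'k) mpoly set"
  interpret additive_subgroup ?P ring_of_type_algebra
    by (rule ideal.axioms(1)) (rule pow_ideal)
  have zero_in: "0 \<in> ?P" using zero_closed unfolding ring_of_type_algebra_simps .
  have add_in: "f + g \<in> ?P" if "f \<in> ?P" "g \<in> ?P" for f g
    using a_closed[OF that] unfolding ring_of_type_algebra_simps .
  show ?thesis using assms
  proof (induction rule: supported_induct)
    case zero
    show ?case using zero_in by simp
  next
    case (add p q)
    then show ?case using add_in by simp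
  next
    case (mon k w)
    obtain a b c i where w: "w = (a, b, c, i)" by (metis prod_cases4)
    have "Polynomial.coeff (const k * mon w) j = (if i = j then Poly_Mapping.single (expv a b c) k else 0)"
      by (simp add: w mon.simps const_def mult_single smult_monom)
    then show ?case using mon zero_in single_in_pow[of a b c i n k] by (auto simp: w)
  qed
qed

text \<open>The two inclusions between \<open>I^j\<close> and \<open>level n j\<close> come from
  \<open>pow_subset_level\<close> and \<open>coeff_in_pow\<close>. From here on, membership in the
  Rees algebra is a condition on supports.\<close>

lemma rees_algebra_eq:
  "rees_algebra (xyz_ideal n) = ring_of_type_algebra \<lparr>carrier := supported (rees_expo n) :: 'k::field bpoly set\<rparr>"
proof -
  have "{p. \<forall>j. Polynomial.coeff p j \<in> xyz_ideal n [^]\<^bsub>ideals_set ring_of_type_algebra\<^esub> j} =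
      (supported (rees_expo n) :: 'k bpoly set)"
    using coeff_in_pow pow_subset_level supported_iff_level by blast
  then show ?thesis by (simp add: rees_algebra_def)
qed

section \<open>The regular sequence in the Rees algebra\<close>

lemma rees_algebra_simps [simp]:
  "carrier (rees_algebra (xyz_ideal n)) = supported (rees_expo n)"
  "x \<otimes>\<^bsub>rees_algebra (xyz_ideal n)\<^esub> y = x * y" "x \<oplus>\<^bsub>rees_algebra (xyz_ideal n)\<^esub> y = x + y"
  "\<one>\<^bsub>rees_algebra (xyz_ideal n)\<^esub> = 1" "\<zero>\<^bsub>rees_algebra (xyz_ideal n)\<^esub> = 0"
  by (simp_all add: rees_algebra_eq ring_of_type_algebra_def)

lemma rees_closed_mult:
  "p \<in> supported (rees_expo n) \<Longrightarrow> q \<in> supported (rees_expo n) \<Longrightarrow> p * q \<in> supported (rees_expo n)"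
  by (rule supported_mult[of _ "rees_expo n" _ "rees_expo n"]) (auto intro: rees_expo_add)

lemma cring_rees_algebra: "cring (rees_algebra (xyz_ideal n) :: 'k::field bpoly ring)"
proof (intro cringI abelian_groupI comm_monoidI)
  have "(1 :: 'k bpoly) \<in> supported (rees_expo n)"
    using supported_mon[of 0 "rees_expo n"] rees_expo_0[of 0 0 0 n] by (simp flip: zero_prod_def)
  then show "\<one>\<^bsub>rees_algebra (xyz_ideal n)\<^esub> \<in> carrier (rees_algebra (xyz_ideal n) :: 'k bpoly ring)" by simp
  fix x assume "x \<in> carrier (rees_algebra (xyz_ideal n) :: 'k bpoly ring)"
  then show "\<exists>y\<in>carrier (rees_algebra (xyz_ideal n)). y \<oplus>\<^bsub>rees_algebra (xyz_ideal n)\<^esub> x = \<zero>\<^bsub>rees_algebra (xyz_ideal n)\<^esub>"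
    by (intro bexI[of _ "- x"]) (auto intro: supported_uminus)
qed (auto simp: algebra_simps intro: supported_add rees_closed_mult)

lemma supported_xyzt:
  "supported (rees_expo_xyzt n) = {mon (1, 1, 1, 1) * p | p. p \<in> supported (rees_expo n)}"
proof (intro subset_antisym subsetI)
  fix p :: "'k::field bpoly" assume "p \<in> supported (rees_expo_xyzt n)"
  then show "p \<in> {mon (1, 1, 1, 1) * p | p. p \<in> supported (rees_expo n)}"
    unfolding rees_expo_xyzt_def by (rule mon_dvd) blast
next
  fix q :: "'k::field bpoly" assume "q \<in> {mon (1, 1, 1, 1) * p | p. p \<in> supported (rees_expo n)}"
  then show "q \<in> supported (rees_expo_xyzt n)"
    by (auto intro!: supported_mon_mult simp: rees_expo_xyzt_def)
qed

lemma generators_in_rees_max_ideal: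
  "mon (1, 1, 1, 1) \<in> rees_max_ideal (xyz_ideal n :: (3, 'k::field) mpoly set)"
  "n > 0 \<Longrightarrow> param1 n \<in> rees_max_ideal (xyz_ideal n :: (3, 'k::field) mpoly set)"
  "n > 0 \<Longrightarrow> param2 n \<in> rees_max_ideal (xyz_ideal n :: (3, 'k::field) mpoly set)"
proof -
  interpret cring "rees_algebra (xyz_ideal n) :: 'k bpoly ring" by (rule cring_rees_algebra)
  let ?M = "rees_max_ideal (xyz_ideal n :: (3, 'k) mpoly set)"
  let ?G = "(\<lambda>i. [:var i:]) ` UNIV \<union> (\<lambda>a. Polynomial.monom a 1) ` (xyz_ideal n :: (3, 'k) mpoly set)"
  have var: "[:var 0:] = (mon (1, 0, 0, 0) :: 'k bpoly)" "[:var 1:] = (mon (0, 1, 0, 0) :: 'k bpoly)"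
    "[:var 2:] = (mon (0, 0, 1, 0) :: 'k bpoly)"
    by (simp_all add: var_def mon.simps expv_def monom_0)
  have G: "?G \<subseteq> carrier (rees_algebra (xyz_ideal n))"
  proof
    fix p assume "p \<in> ?G"
    then consider i where "p = [:var i:]" | a where "a \<in> xyz_ideal n" "p = Polynomial.monom a 1" by blast
    then show "p \<in> carrier (rees_algebra (xyz_ideal n))"
    proof cases
      case 1
      have "mon (a, b, c, 0) \<in> supported (rees_expo n)" for a b c
        by (rule supported_mon) (rule rees_expo_0)
      then show ?thesis using 1 exhaust_three[of i] var by auto
    next
      case 2
      then show ?thesis using mon_ideal_subset_level by (auto simp: level_def)
    qed
  qed
  have M: "ideal ?M (rees_algebra (xyz_ideal n))"
    unfolding rees_max_ideal_def using G by (rule genideal_ideal)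
  have GM: "?G \<subseteq> ?M"
    unfolding rees_max_ideal_def using G by (rule genideal_self)
  have t: "mon (a, b, c, 1) \<in> ?M" if "Poly_Mapping.single (expv a b c) 1 \<in> (xyz_ideal n :: (3, 'k) mpoly set)" for a b c
    using GM that by (auto simp: mon.simps)
  show "mon (1, 1, 1, 1) \<in> ?M" by (rule t[OF single_in_mon_ideal(4)])
  assume n: "n > 0"
  have mult: "mon v * mon w \<in> ?M" if "v \<in> rees_expo n" "mon w \<in> ?M" for v w
    using ideal.I_l_closed[OF M that(2), of "mon v"] that(1) by (simp add: supported_mon)
  have "[:var 0:] \<in> ?M" "[:var 1:] \<in> ?M" using GM by blast+
  then have "mon (1, 0, 0, 0) \<in> ?M" "mon (0, 1, 0, 0) \<in> ?M" unfolding var .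
  \<comment> \<open>The terms without \<open>t\<close> come from the generators \<open>x\<close> and
    \<open>y\<close> of the maximal ideal, the terms with \<open>t\<close> from
    \<open>It\<close>.\<close>
  then have "mon (n - 1, 0, 0, 0) * mon (1, 0, 0, 0) \<in> ?M" "mon (0, n - 1, 0, 0) * mon (0, 1, 0, 0) \<in> ?M"
    by (intro mult rees_expo_0; simp)+
  then have "mon (n, 0, 0, 0) \<in> ?M" "mon (0, n, 0, 0) \<in> ?M"
    using n by (simp_all flip: mon_add)
  moreover have "p + q \<in> ?M" if "p \<in> ?M" "q \<in> ?M" for p q
    using additive_subgroup.a_closed[OF ideal.axioms(1)[OF M] that] by simp
  moreover have "mon (n, 0, 0, 1) \<in> ?M" "mon (0, n, 0, 1) \<in> ?M" "mon (0, 0, n, 1) \<in> ?M"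
    by (intro t single_in_mon_ideal)+
  ultimately show "param1 n \<in> ?M" "param2 n \<in> ?M"
    unfolding param1_def param2_def by blast+
qed

text \<open>\<open>xyzt\<close> is regular because the polynomial ring is a domain; the other two
  conditions are the clauses of \<open>reg_pair_xyzt\<close>. The bounds \<open>ideal0\<close>,
  \<open>ideal1\<close>, \<open>ideal2\<close> translate assumptions on generated ideals into
  supports, and \<open>comb\<close> and \<open>add\<close> translate conclusions back.\<close>

lemma regular_sequence_rees:
  assumes n: "n \<ge> 3"
  shows "regular_sequence (rees_algebra (xyz_ideal n :: (3, 'k::field) mpoly set))
    [mon (1, 1, 1, 1), param1 n, param2 n]"
proof -
  let ?R = "rees_algebra (xyz_ideal n) :: 'k bpoly ring"
  let ?A = "supported (rees_expo n) :: 'k bpoly set" and ?T = "supported (rees_expo_xyzt n) :: 'k bpoly set"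
  interpret cring ?R by (rule cring_rees_algebra)
  define s where "s = (mon (1, 1, 1, 1) :: 'k bpoly)"
  define g1 where "g1 = (param1 n :: 'k bpoly)"
  define g2 where "g2 = (param2 n :: 'k bpoly)"
  have reg: "reg_pair g1 g2 ?A ?T" unfolding g1_def g2_def by (rule reg_pair_xyzt[OF n])
  have gens: "s \<in> ?A" "g1 \<in> ?A" "g2 \<in> ?A"
    unfolding s_def g1_def g2_def param1_def param2_def
    using rees_expo_gens[of n] rees_expo_0 by (auto intro!: supported_add supported_mon)
  have T: "t \<in> ?T \<longleftrightarrow> (\<exists>p\<in>?A. t = s * p)" for t
    unfolding supported_xyzt s_def by blast
  have ideal0: "Idl\<^bsub>?R\<^esub> {} \<subseteq> {0}" using genideal_minimal[OF zeroideal, of "{}"] by (simp only: rees_algebra_simps) simp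
  have mono: "ideal (Idl\<^bsub>?R\<^esub> G) ?R \<and> G \<subseteq> Idl\<^bsub>?R\<^esub> G" if "G \<subseteq> ?A" for G
    using that genideal_ideal genideal_self by simp
  have comb: "x * p \<in> Idl\<^bsub>?R\<^esub> G" if "G \<subseteq> ?A" "x \<in> G" "p \<in> ?A" for G x p
    using mono[OF that(1)] ideal.I_r_closed[of _ ?R x p] that by auto
  have add: "p + q \<in> Idl\<^bsub>?R\<^esub> G" if "G \<subseteq> ?A" "p \<in> Idl\<^bsub>?R\<^esub> G" "q \<in> Idl\<^bsub>?R\<^esub> G" for G p q
    using mono[OF that(1)] additive_subgroup.a_closed[OF ideal.axioms(1), of _ ?R p q] that by auto
  have ideal1: "Idl\<^bsub>?R\<^esub> {s} \<subseteq> ?T"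
  proof (rule genideal_minimal)
    show "ideal ?T ?R"
    proof (rule idealI_mult)
      show "?T \<subseteq> carrier ?R" using T gens(1) rees_closed_mult by auto
      fix x a assume "x \<in> carrier ?R" "a \<in> ?T"
      then show "x \<otimes>\<^bsub>?R\<^esub> a \<in> ?T" unfolding T by (auto simp: mult.left_commute rees_closed_mult)
    qed (auto intro: supported_add)
    show "{s} \<subseteq> ?T" using T[of s] one_closed by (auto intro!: bexI[of _ 1])
  qed
  have ideal2: "Idl\<^bsub>?R\<^esub> {s, g1} \<subseteq> {t + g1 * a | t a. t \<in> ?T \<and> a \<in> ?A}" (is "_ \<subseteq> ?J")
  proof (rule genideal_minimal)
    show "ideal ?J ?R"
    proof (rule idealI_mult)
      show "?J \<subseteq> carrier ?R" using T gens by (auto intro!: supported_add rees_closed_mult)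
      show "\<zero>\<^bsub>?R\<^esub> \<in> ?J" by (auto intro!: exI[of _ 0])
      fix p q assume "p \<in> ?J" "q \<in> ?J"
      then obtain t a t' a' where pq: "p = t + g1 * a" "q = t' + g1 * a'" "t \<in> ?T" "t' \<in> ?T" "a \<in> ?A" "a' \<in> ?A"
        by blast
      then have "p \<oplus>\<^bsub>?R\<^esub> q = (t + t') + g1 * (a + a')" by (simp add: algebra_simps)
      then show "p \<oplus>\<^bsub>?R\<^esub> q \<in> ?J" using pq supported_add by blast
    next
      fix x p assume x: "x \<in> carrier ?R" and "p \<in> ?J"
      then obtain t a where p: "p = t + g1 * a" "t \<in> ?T" "a \<in> ?A" by blast
      then have "x \<otimes>\<^bsub>?R\<^esub> p = x * t + g1 * (x * a)" by (simp add: algebra_simps)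
      moreover have "x * t \<in> ?T" "x * a \<in> ?A"
        using x p(2,3) unfolding T by (auto simp: mult.left_commute rees_closed_mult)
      ultimately show "x \<otimes>\<^bsub>?R\<^esub> p \<in> ?J" by blast
    qed
    have "s = s * 1 + g1 * 0" "g1 = 0 + g1 * 1" by simp_all
    then show "{s, g1} \<subseteq> ?J" using T[of "s * 1"] one_closed zero_closed by fastforce
  qed
  have proper: "Idl\<^bsub>?R\<^esub> {s, g1, g2} \<noteq> carrier ?R"
  proof -
    \<comment> \<open>The elements of \<open>A\<close> without constant term: an ideal that contains
      the sequence but not 1.\<close>
    let ?N = "supported (rees_expo n - {0}) :: 'k bpoly set"
    have "Idl\<^bsub>?R\<^esub> {s, g1, g2} \<subseteq> ?N"
    proof (rule genideal_minimal)
      show "ideal ?N ?R"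
      proof (rule idealI_mult)
        show "?N \<subseteq> carrier ?R" by (auto elim: supported_mono)
        fix x a assume "x \<in> carrier ?R" and a: "a \<in> ?N"
        then have "x \<in> ?A" by simp
        then have "x * a \<in> ?N" using a
          by (rule supported_mult) (auto intro: rees_expo_add simp: zero_prod_def)
        then show "x \<otimes>\<^bsub>?R\<^esub> a \<in> ?N" by simp
      qed (auto intro: supported_add)
      show "{s, g1, g2} \<subseteq> ?N"
        unfolding s_def g1_def g2_def param1_def param2_def
        using rees_expo_gens[of n] rees_expo_0 n
        by (auto intro!: supported_add supported_mon simp: zero_prod_def)
    qed
    moreover have "1 \<notin> ?N"
    proof
      assume "1 \<in> ?N"
      then have "cf (mon 0) 0 = (0 :: 'k)" by (intro supportedD[of _ "rees_expo n - {0}"]) auto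
      then show False by (simp add: cf_mon del: mon_zero)
    qed
    ultimately show ?thesis using one_closed by auto
  qed
  have "b \<in> Idl\<^bsub>?R\<^esub> {}" if "b \<in> ?A" "s * b \<in> Idl\<^bsub>?R\<^esub> {}" for b
  proof -
    have "s * b = 0" using that ideal0 by blast
    then show ?thesis using that by (simp add: s_def)
  qed
  moreover have "b \<in> Idl\<^bsub>?R\<^esub> {s}" if "b \<in> ?A" "g1 * b \<in> Idl\<^bsub>?R\<^esub> {s}" for b
  proof -
    have "b \<in> ?T" using reg that ideal1 unfolding reg_pair_def by blast
    then show ?thesis using T comb[of "{s}" s] gens by auto
  qed
  moreover have "b \<in> Idl\<^bsub>?R\<^esub> {s, g1}" if b: "b \<in> ?A" and g2b: "g2 * b \<in> Idl\<^bsub>?R\<^esub> {s, g1}" for b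
  proof -
    obtain t a where ta: "g2 * b = t + g1 * a" "t \<in> ?T" "a \<in> ?A" using ideal2 g2b by blast
    then have "g2 * b - g1 * a \<in> ?T" by simp
    then obtain c where c: "c \<in> ?A" "b - g1 * c \<in> ?T"
      using reg ta(3) b unfolding reg_pair_def by blast
    then obtain d where d: "d \<in> ?A" "b - g1 * c = s * d" using T by blast
    have "b = s * d + g1 * c" using d(2) by (simp add: algebra_simps)
    then show ?thesis using add comb[of "{s, g1}"] gens c(1) d(1) by simp
  qed
  ultimately show ?thesis
    unfolding regular_sequence_def s_def[symmetric] g1_def[symmetric] g2_def[symmetric]
    using gens proper by (auto simp: less_Suc_eq numeral_3_eq_3)
qed

theorem proposition4p12:
  fixes n :: nat
  assumes "infinite (UNIV :: 'k::field set)"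
    and "n \<ge> 3"
  shows "almost_Cohen_Macaulay_rees (mon_ideal n n n 1 1 1 :: (3, 'k) mpoly set)"
proof -
  let ?xs = "[mon (1, 1, 1, 1), param1 n, param2 n] :: 'k bpoly list"
  have "?xs \<in> {xs. regular_sequence (rees_algebra (xyz_ideal n)) xs \<and> set xs \<subseteq> rees_max_ideal (xyz_ideal n)}"
    using regular_sequence_rees[OF assms(2)] generators_in_rees_max_ideal[of n] assms(2) by auto
  \<comment> \<open>As \<open>depth\<close> is a supremum of lengths, one regular sequence of length
    3 in the maximal ideal gives the bound.\<close>
  then have "enat (length ?xs) \<le> depth (rees_algebra (xyz_ideal n)) (rees_max_ideal (xyz_ideal n :: (3, 'k) mpoly set))"
    unfolding depth_def by (rule SUP_upper)
  then show ?thesis by (simp add: almost_Cohen_Macaulay_rees_def xyz_ideal_def numeral_3_eq_3)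
qed

end
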